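(* Let $G$ be a non-locally compact GO-space which is rectifiable, let $bG$ be a Hausdorff compactification of $G$, and let $Y=bG\setminus G$. If $Y$ has locally a point-countable $p$-metabase, then $G$ and $bG$ are separable and metrizable.
   Context: All spaces are Tychonoff. A topological space $G$ is rectifiable if there are an element $e\in G$ and a surjective homeomorphism $\varphi:G\times G\to G\times G$ such that $\pi_1\circ\varphi=\pi_1$ and $\varphi(x,x)=(x,e)$ for every $x\in G$, where $\pi_1:G\times G\to G$ is the projection to the first coordinate. A LOTS is a linearly ordered set with its open-interval topology. A GO-space (suborderable space) is a topological space homeomorphic to a subspace of a LOTS. A space is locally compact if every point has a compact neighborhood. A collection $\mathcal{A}$ of subsets of a space $X$ is a $p$-metabase for $X$ if for any distinct points $x,y\in X$ there is a finite subfamily $\mathcal{F}\subset\mathcal{A}$ such that $x\in(\bigcup\mathcal{F})^{\circ}\subset\bigcup\mathcal{F}\subset X\setminus\{y\}$, where $^{\circ}$ denotes interior in $X$. A collection is point-countable if every point belongs to at most countably many of its members. A space has a property locally if every point has a neighborhood with that property. *)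

theory Defs
  imports "HOL-Analysis.Analysis"
begin

definition Tychonoff_space :: "'a topology \<Rightarrow> bool" where
  "Tychonoff_space X \<longleftrightarrow> completely_regular_space X \<and> Hausdorff_space X"

definition rectifiable_space :: "'a topology \<Rightarrow> bool" where
  "rectifiable_space G \<longleftrightarrow>
    (\<exists>e \<in> topspace G. \<exists>\<phi>.
        homeomorphic_map (prod_topology G G) (prod_topology G G) \<phi> \<and>
        (\<forall>z \<in> topspace (prod_topology G G). fst (\<phi> z) = fst z) \<and>
        (\<forall>x \<in> topspace G. \<phi> (x, x) = (x, e)))"

text \<open>A GO-space is homeomorphic to a subspace of some LOTS. The LOTS is a type \<open>'l\<close> of class
  \<^class>\<open>linorder_topology\<close>. HOL cannot quantify existentially over it inside the
  definition, so it is a parameter: a theorem that assumes \<open>GO_space TYPE('l) X\<close> with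
  \<open>'l\<close> a free type variable holds whatever the ambient LOTS is.\<close>

definition GO_space :: "'l::linorder_topology itself \<Rightarrow> 'a topology \<Rightarrow> bool" where
  "GO_space L X \<longleftrightarrow>
    (\<exists>S :: 'l set. X homeomorphic_space subtopology (euclidean :: 'l topology) S)"

definition Hausdorff_compactification :: "'a topology \<Rightarrow> 'b topology \<Rightarrow> ('a \<Rightarrow> 'b) \<Rightarrow> bool" where
  "Hausdorff_compactification X bX i \<longleftrightarrow>
    compact_space bX \<and> Hausdorff_space bX \<and> embedding_map X bX i \<and>
    bX closure_of (i ` topspace X) = topspace bX"

definition remainder :: "'a topology \<Rightarrow> 'b topology \<Rightarrow> ('a \<Rightarrow> 'b) \<Rightarrow> 'b topology" where
  "remainder X bX i = subtopology bX (topspace bX - i ` topspace X)"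

definition p_metabase :: "'a topology \<Rightarrow> 'a set set \<Rightarrow> bool" where
  "p_metabase X \<A> \<longleftrightarrow>
    \<A> \<subseteq> Pow (topspace X) \<and>
    (\<forall>x \<in> topspace X. \<forall>y \<in> topspace X. x \<noteq> y \<longrightarrow>
      (\<exists>\<F>. finite \<F> \<and> \<F> \<subseteq> \<A> \<and>
           x \<in> X interior_of \<Union>\<F> \<and> \<Union>\<F> \<subseteq> topspace X - {y}))"

definition point_countable :: "'a topology \<Rightarrow> 'a set set \<Rightarrow> bool" where
  "point_countable X \<A> \<longleftrightarrow> (\<forall>x \<in> topspace X. countable {A \<in> \<A>. x \<in> A})"

definition has_point_countable_p_metabase :: "'a topology \<Rightarrow> bool" where
  "has_point_countable_p_metabase X \<longleftrightarrow> (\<exists>\<A>. p_metabase X \<A> \<and> point_countable X \<A>)"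

text \<open>One neighbourhood \<open>N\<close> per point, not necessarily open and not a whole neighbourhood base
  as in the library's \<open>neighbourhood_base_of\<close>.\<close>

definition has_locally :: "('a topology \<Rightarrow> bool) \<Rightarrow> 'a topology \<Rightarrow> bool" where
  "has_locally P X \<longleftrightarrow>
    (\<forall>x \<in> topspace X. \<exists>U N. openin X U \<and> x \<in> U \<and> U \<subseteq> N \<and> N \<subseteq> topspace X \<and>
       P (subtopology X N))"

end

theory Submission
  imports Defs
begin

text \<open>Write \<open>X\<close> for the compactification, \<open>S\<close> for the copy of \<open>G\<close> in it and \<open>Y = X - S\<close>. A compact
  Hausdorff space with a countable network is metrizable and separable together with all its
  subspaces, so everything reduces to a countable network for \<open>X\<close>. A rectifiable space is
  homogeneous; as \<open>G\<close> is not locally compact, it is locally compact at no point, and \<open>Y\<close> is dense.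

  The main device is a closing-off argument in the style of Mishchenko's lemma
  (\<open>compact_separable_by_closing_off\<close>). Let \<open>\<P>\<close> be a point-countable p-metabase and \<open>D\<close> a countable
  subset of a set \<open>A\<close>, such that every finite family of members of \<open>\<P>\<close> that meet \<open>D\<close> covers \<open>A\<close> if it
  covers \<open>D\<close>. If \<open>z \<in> A\<close> were outside the closure of \<open>D\<close>, and that closure were compact, the closure
  would be covered by a finite subfamily of \<open>\<P>\<close> whose union misses \<open>z\<close>; the members that meet \<open>D\<close>
  still cover \<open>D\<close> and still miss \<open>z\<close>, against the choice of \<open>D\<close>. After the thinning
  out only the points of \<open>D\<close> itself have to stay covered, which is why interiors of finite unions
  can play the role of open members.

  The order of \<open>G\<close> enters once. At a point of a suborderable space, either both sides have
  a countable base, or one side has none, and then any countably many neighbourhoods of the point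
  have a common nonempty open subset (\<open>GO_space_point_dichotomy\<close>). In the second case the
  rectification turns that subset into a common neighbourhood, so that \<open>G\<close> is a P-space
  (\<open>P_space_if_countable_open_core\<close>). Then closures of countable subsets of \<open>Y\<close> stay in \<open>Y\<close>,
  so the device makes \<open>Y\<close> locally compact. As a dense locally compact subset of \<open>X\<close>, the set \<open>Y\<close> is
  then open, and the density of \<open>S\<close> is violated.

  In the first case \<open>G\<close> has a countable base at the base point \<open>e\<close> of the rectification. The
  division map of the rectification spreads it to countable families \<open>B d\<close> of open sets, for \<open>d \<in> S\<close>, such that the families of the points of
  any \<open>D \<subseteq> S\<close> together contain a base at every point of \<open>S\<close> in the closure of \<open>D\<close>
  (\<open>base_from_dense_subset\<close>). With these the device, applied four times, shows in turn: the points
  of \<open>Y\<close> in closures of countable subsets of \<open>S\<close> are dense; every open set whose closure meets \<open>Y\<close> in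
  a space with a point-countable p-metabase lies in the closure of a countable subset of \<open>S\<close>; its
  intersection with \<open>Y\<close> is hereditarily separable, which with one more closing-off yields
  a countable network of the open set (\<open>open_set_countably_networked\<close>); and the compact set \<open>L\<close> of points
  without a countably networked neighbourhood, which lies in \<open>S\<close>, has a countable outer base. Thus
  \<open>X - L\<close> is \<open>\<sigma>\<close>-compact and the local networks combine to a countable network of \<open>X\<close>.\<close>

section \<open>Closing off countable sets\<close>

text \<open>Adding \<open>g F\<close> for all admissible finite \<open>F\<close> makes more finite sets admissible. Iterating \<open>\<omega>\<close> times
  suffices, because a finite subset of the union of the increasing stages appears at some stage.\<close>

lemma countable_closing_off:
  assumes R: "\<And>a. a \<in> A \<Longrightarrow> countable (R a)"
    and g: "\<And>F. finite F \<Longrightarrow> countable (g F) \<and> g F \<subseteq> A"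
  obtains D where "countable D" "D \<subseteq> A"
    "\<And>F. finite F \<Longrightarrow> F \<subseteq> (\<Union>d\<in>D. R d) \<Longrightarrow> g F \<subseteq> D"
proof -
  define step where "step D = D \<union> (\<Union>F\<in>{F. finite F \<and> F \<subseteq> (\<Union>d\<in>D. R d)}. g F)" for D
  define E where "E n = (step ^^ n) {}" for n
  have E: "E 0 = {}" "E (Suc n) = step (E n)" for n
    by (auto simp: E_def)
  have sub: "countable (E n) \<and> E n \<subseteq> A" for n
  proof (induction n)
    case (Suc n)
    then have "countable (\<Union>d\<in>E n. R d)"
      using R by blast
    then have "countable {F. finite F \<and> F \<subseteq> (\<Union>d\<in>E n. R d)}"
      by (rule countable_Collect_finite_subset)
    then show ?case
      using Suc g by (auto simp: E step_def)
  qed (simp add: E)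
  have mono: "mono E"
    by (intro mono_iff_le_Suc[THEN iffD2] allI) (auto simp: E step_def)
  show thesis
  proof (rule that)
    show "countable (\<Union>n. E n)" "(\<Union>n. E n) \<subseteq> A"
      using sub by auto
    fix F assume "finite F" "F \<subseteq> (\<Union>d\<in>(\<Union>n. E n). R d)"
    then have "\<exists>n. F \<subseteq> (\<Union>d\<in>E n. R d)"
    proof (induction F)
      case (insert x F)
      then obtain n where n: "F \<subseteq> (\<Union>d\<in>E n. R d)"
        by auto
      obtain m where m: "x \<in> (\<Union>d\<in>E m. R d)"
        using insert.prems by auto
      have "E n \<subseteq> E (max m n)" "E m \<subseteq> E (max m n)"
        using monoD[OF mono] by auto
      then have "insert x F \<subseteq> (\<Union>d\<in>E (max m n). R d)"
        using m n by blast
      then show ?case ..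
    qed auto
    then obtain n where "F \<subseteq> (\<Union>d\<in>E n. R d)" ..
    then have "g F \<subseteq> E (Suc n)"
      using \<open>finite F\<close> by (auto simp: E step_def)
    then show "g F \<subseteq> (\<Union>n. E n)"
      by blast
  qed
qed

text \<open>Covering only \<open>W \<inter> M\<close> by \<open>\<Union>F\<close> is what a p-metabase of a subspace \<open>M\<close> provides, and it
  survives when \<open>F\<close> is thinned out to its members that meet \<open>M\<close>.\<close>

lemma compactin_finite_cover_avoiding:
  assumes K: "compactin X K"
    and sep: "\<And>x. x \<in> K \<Longrightarrow> \<exists>W F. openin X W \<and> x \<in> W \<and> finite F \<and> F \<subseteq> \<Q> \<and> W \<inter> M \<subseteq> \<Union>F \<and> z \<notin> \<Union>F"
  shows "\<exists>F. finite F \<and> F \<subseteq> \<Q> \<and> K \<inter> M \<subseteq> \<Union>F \<and> z \<notin> \<Union>F"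
proof -
  obtain W F where WF: "\<And>x. x \<in> K \<Longrightarrow> openin X (W x) \<and> x \<in> W x \<and> finite (F x)
      \<and> F x \<subseteq> \<Q> \<and> W x \<inter> M \<subseteq> \<Union>(F x) \<and> z \<notin> \<Union>(F x)"
    using sep by metis
  have "\<forall>U\<in>W ` K. openin X U" "K \<subseteq> \<Union>(W ` K)"
    using WF by auto
  then obtain \<W> where "finite \<W>" "\<W> \<subseteq> W ` K" "K \<subseteq> \<Union>\<W>"
    using K unfolding compactin_def by meson
  then obtain T where T: "finite T" "T \<subseteq> K" "K \<subseteq> \<Union>(W ` T)"
    using finite_subset_image[of \<W> W K] by metis
  show ?thesis
  proof (intro exI[of _ "\<Union>x\<in>T. F x"] conjI)
    show "finite (\<Union>x\<in>T. F x)" "(\<Union>x\<in>T. F x) \<subseteq> \<Q>" "z \<notin> \<Union>(\<Union>x\<in>T. F x)"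
      using T WF by (auto simp: subset_iff)
    show "K \<inter> M \<subseteq> \<Union>(\<Union>x\<in>T. F x)"
    proof
      fix d assume d: "d \<in> K \<inter> M"
      then obtain x where "x \<in> T" "d \<in> W x"
        using T by blast
      then show "d \<in> \<Union>(\<Union>x\<in>T. F x)"
        using WF[of x] T d by blast
    qed
  qed
qed

text \<open>If \<open>D\<close> is closed off so that no finite union of sets from its families covers \<open>D\<close> without
  covering \<open>A\<close>, a point of \<open>A\<close> outside the closure of \<open>D\<close> contradicts the compactness of that
  closure. The separation is demanded only for countable \<open>D \<subseteq> A\<close>, so that properties of closures of
  countable sets can be used to establish it.\<close>

lemma compact_separable_by_closing_off:
  assumes X: "compact_space X" "A \<subseteq> topspace X"
    and R: "\<And>a. a \<in> A \<Longrightarrow> countable (R a)"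
    and sep: "\<And>D x z. \<lbrakk>countable D; D \<subseteq> A; x \<in> X closure_of D; z \<in> A; z \<notin> X closure_of D\<rbrakk>
       \<Longrightarrow> \<exists>W F. openin X W \<and> x \<in> W \<and> finite F \<and> F \<subseteq> (\<Union>d\<in>D. R d) \<and> W \<inter> D \<subseteq> \<Union>F \<and> z \<notin> \<Union>F"
  obtains D where "countable D" "D \<subseteq> A" "A \<subseteq> X closure_of D"
proof -
  define g where "g F = (if A \<subseteq> \<Union>F then {} else {SOME a. a \<in> A - \<Union>F})" for F
  have some: "(SOME a. a \<in> A - \<Union>F) \<in> A - \<Union>F" if "\<not> A \<subseteq> \<Union>F" for F
    by (rule some_in_eq[THEN iffD2]) (use that in blast)
  have g: "countable (g F) \<and> g F \<subseteq> A" for F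
    using some[of F] by (auto simp: g_def)
  obtain D where D: "countable D" "D \<subseteq> A"
    and closed: "\<And>F. finite F \<Longrightarrow> F \<subseteq> (\<Union>d\<in>D. R d) \<Longrightarrow> g F \<subseteq> D"
    using countable_closing_off[of A R g] R g by metis
  have "z \<in> X closure_of D" if z: "z \<in> A" for z
  proof (rule ccontr)
    assume nz: "z \<notin> X closure_of D"
    have cK: "compactin X (X closure_of D)"
      using X by (simp add: closedin_compact_space)
    have sepD: "\<exists>W F. openin X W \<and> x \<in> W \<and> finite F \<and> F \<subseteq> (\<Union>d\<in>D. R d) \<and> W \<inter> D \<subseteq> \<Union>F \<and> z \<notin> \<Union>F"
      if "x \<in> X closure_of D" for x
      by (rule sep[OF D that z nz])
    have "\<exists>H. finite H \<and> H \<subseteq> (\<Union>d\<in>D. R d) \<and> X closure_of D \<inter> D \<subseteq> \<Union>H \<and> z \<notin> \<Union>H"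
      by (rule compactin_finite_cover_avoiding[OF cK sepD])
    then obtain H where H: "finite H" "H \<subseteq> (\<Union>d\<in>D. R d)" and cover: "X closure_of D \<inter> D \<subseteq> \<Union>H"
      and zH: "z \<notin> \<Union>H"
      by (elim exE conjE)
    have "X closure_of D \<inter> D = D"
      using closure_of_subset[OF subset_trans[OF D(2) X(2)]] by (rule Int_absorb1)
    then have "D \<subseteq> \<Union>H"
      using cover by simp
    have "\<not> A \<subseteq> \<Union>H"
      using zH z by (meson subsetD)
    then have "(SOME a. a \<in> A - \<Union>H) \<in> D"
      using closed[of H] H by (simp add: g_def)
    then show False
      using some[OF \<open>\<not> A \<subseteq> \<Union>H\<close>] \<open>D \<subseteq> \<Union>H\<close> by (meson DiffD2 subsetD)
  qed
  then show thesis
    using D that by blast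
qed

lemma regular_space_closure_nbhd:
  assumes "regular_space X" "openin X U" "x \<in> U"
  obtains V where "openin X V" "x \<in> V" "X closure_of V \<subseteq> U"
proof -
  have "neighbourhood_base_of (closedin X) X"
    using assms(1) by (simp add: neighbourhood_base_of_closedin)
  then obtain V C where "openin X V" "closedin X C" "x \<in> V" "V \<subseteq> C" "C \<subseteq> U"
    using assms(2,3) unfolding neighbourhood_base_of by meson
  then show thesis
    using that[of V] closure_of_minimal[of V C X] by blast
qed

section \<open>Countable networks\<close>

text \<open>A countable network of \<open>X\<close> at the points of \<open>A\<close>. The members of \<open>\<N>\<close> may stick out of \<open>A\<close>,
  so the notion is monotone in \<open>A\<close> and compatible with countable unions.\<close>

definition countably_networked :: "'a topology \<Rightarrow> 'a set \<Rightarrow> bool" where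
  "countably_networked X A \<longleftrightarrow>
    (\<exists>\<N>. countable \<N> \<and> (\<forall>x\<in>A. \<forall>U. openin X U \<and> x \<in> U \<longrightarrow> (\<exists>N\<in>\<N>. x \<in> N \<and> N \<subseteq> U)))"

lemma countably_networkedE:
  assumes "countably_networked X A"
  obtains \<N> where "countable \<N>"
    "\<And>x U. x \<in> A \<Longrightarrow> openin X U \<Longrightarrow> x \<in> U \<Longrightarrow> \<exists>N\<in>\<N>. x \<in> N \<and> N \<subseteq> U"
proof -
  from assms obtain \<N> where "countable \<N> \<and>
      (\<forall>x\<in>A. \<forall>U. openin X U \<and> x \<in> U \<longrightarrow> (\<exists>N\<in>\<N>. x \<in> N \<and> N \<subseteq> U))"
    unfolding countably_networked_def by (rule exE)
  then show thesis
    by (intro that) auto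
qed

lemma countably_networked_subset:
  "countably_networked X B \<Longrightarrow> A \<subseteq> B \<Longrightarrow> countably_networked X A"
  unfolding countably_networked_def by (elim exE) (rule exI, auto)

lemma countably_networked_UN:
  assumes "countable I" "\<And>i. i \<in> I \<Longrightarrow> countably_networked X (A i)"
  shows "countably_networked X (\<Union>i\<in>I. A i)"
proof -
  obtain \<N> where \<N>: "\<And>i. i \<in> I \<Longrightarrow> countable (\<N> i) \<and>
      (\<forall>x\<in>A i. \<forall>U. openin X U \<and> x \<in> U \<longrightarrow> (\<exists>N\<in>\<N> i. x \<in> N \<and> N \<subseteq> U))"
    using assms(2) unfolding countably_networked_def by metis
  show ?thesis
    unfolding countably_networked_def
  proof (intro exI conjI)
    show "countable (\<Union>i\<in>I. \<N> i)"
      using assms(1) \<N> by blast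
    show "\<forall>x\<in>\<Union>i\<in>I. A i. \<forall>U. openin X U \<and> x \<in> U \<longrightarrow> (\<exists>N\<in>\<Union>i\<in>I. \<N> i. x \<in> N \<and> N \<subseteq> U)"
    proof clarify
      fix x U i assume "openin X U" "x \<in> U" "i \<in> I" "x \<in> A i"
      then obtain N where "N \<in> \<N> i" "x \<in> N" "N \<subseteq> U"
        using \<N>[of i] by meson
      then show "\<exists>N\<in>\<Union>i\<in>I. \<N> i. x \<in> N \<and> N \<subseteq> U"
        using \<open>i \<in> I\<close> by (intro bexI[of _ N]) auto
    qed
  qed
qed

lemma countably_networked_Un:
  "countably_networked X A \<Longrightarrow> countably_networked X B \<Longrightarrow> countably_networked X (A \<union> B)"
  using countably_networked_UN[of UNIV X "\<lambda>b. if b then A else B"] by (simp add: UNIV_bool Un_commute)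

lemma countably_networked_imp_separable:
  assumes "countably_networked X A" "A \<subseteq> topspace X"
  shows "separable_space (subtopology X A)"
proof -
  obtain \<N> where \<N>: "countable \<N>"
    "\<And>x U. x \<in> A \<Longrightarrow> openin X U \<Longrightarrow> x \<in> U \<Longrightarrow> \<exists>N\<in>\<N>. x \<in> N \<and> N \<subseteq> U"
    by (rule countably_networkedE[OF assms(1)], rule that) auto
  define c where "c N = (SOME x. x \<in> A \<inter> N)" for N
  have c: "c N \<in> A \<inter> N" if "x \<in> A" "x \<in> N" for x N
    unfolding c_def by (rule some_in_eq[THEN iffD2]) (use that in blast)
  define C where "C = A \<inter> c ` \<N>"
  have "\<exists>y\<in>C. y \<in> T" if xT: "x \<in> A" "openin (subtopology X A) T" "x \<in> T" for x T
  proof -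
    obtain U where "openin X U" "T = U \<inter> A"
      using xT(2) unfolding openin_subtopology by blast
    then obtain N where "N \<in> \<N>" "x \<in> N" "N \<subseteq> U"
      using \<N>(2)[of x U] xT by auto
    then show ?thesis
      using c[of x N] xT \<open>T = U \<inter> A\<close> by (auto simp: C_def)
  qed
  then have "subtopology X A closure_of C = topspace (subtopology X A)"
    using assms(2) by (auto simp: closure_of_def)
  then show ?thesis
    unfolding separable_space_def using \<N>(1) assms(2) by (intro exI[of _ C]) (auto simp: C_def)
qed

text \<open>Whenever two members of the network can be separated by a continuous real function, choose one
  such function. These countably many functions separate points, because distinct points have
  disjoint closed neighbourhoods that each contain a member of the network around the point. They
  embed the compact space into a countable power of the line.\<close>

lemma compact_Hausdorff_countably_networked_imp_metrizable:
  assumes X: "compact_space X" "Hausdorff_space X" and net: "countably_networked X (topspace X)"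
  shows "metrizable_space X"
proof -
  have nX: "normal_space X" and rX: "regular_space X"
    using X by (auto simp: compact_Hausdorff_or_regular_imp_normal_space compact_Hausdorff_imp_regular_space)
  obtain \<N> where \<N>: "countable \<N>"
    "\<And>x U. x \<in> topspace X \<Longrightarrow> openin X U \<Longrightarrow> x \<in> U \<Longrightarrow> \<exists>N\<in>\<N>. x \<in> N \<and> N \<subseteq> U"
    by (rule countably_networkedE[OF net], rule that) auto
  define sepf where "sepf p f \<longleftrightarrow> continuous_map X euclideanreal f \<and> f ` fst p \<subseteq> {0} \<and> f ` snd p \<subseteq> {1}"
    for p :: "'a set \<times> 'a set" and f
  define I where "I = {p \<in> \<N> \<times> \<N>. \<exists>f. sepf p f}"
  define f where "f p = (SOME f. sepf p f)" for p
  have f: "sepf p (f p)" if "p \<in> I" for p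
  proof -
    have "\<exists>f. sepf p f"
      using that by (simp add: I_def)
    then show ?thesis
      unfolding f_def by (rule someI_ex)
  qed
  have cI: "countable I"
    using \<N>(1) by (simp add: I_def)
  define Z where "Z = product_topology (\<lambda>_. euclideanreal) I"
  define h where "h x = (\<lambda>p\<in>I. f p x)" for x
  have "continuous_map X Z h"
    unfolding Z_def continuous_map_componentwise h_def using f by (auto simp: sepf_def)
  have inj: "inj_on h (topspace X)"
  proof (rule inj_onI, rule ccontr)
    fix x y assume xy: "x \<in> topspace X" "y \<in> topspace X" "h x = h y" "x \<noteq> y"
    then obtain U V where UV: "openin X U" "openin X V" "x \<in> U" "y \<in> V" "disjnt U V"
      using X by (metis Hausdorff_space_def)
    obtain C where C: "openin X C" "x \<in> C" "X closure_of C \<subseteq> U"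
      using regular_space_closure_nbhd[OF rX] UV by metis
    obtain C' where C': "openin X C'" "y \<in> C'" "X closure_of C' \<subseteq> V"
      using regular_space_closure_nbhd[OF rX] UV by metis
    obtain N N' where N: "N \<in> \<N>" "x \<in> N" "N \<subseteq> C" "N' \<in> \<N>" "y \<in> N'" "N' \<subseteq> C'"
      using \<N>(2)[OF xy(1) C(1,2)] \<N>(2)[OF xy(2) C'(1,2)] by auto
    have "disjnt (X closure_of C) (X closure_of C')"
      using UV C C' by (meson disjnt_subset1 disjnt_subset2)
    then obtain u :: "'a \<Rightarrow> real" where u: "continuous_map X (top_of_set {0..1}) u"
        "u ` (X closure_of C) \<subseteq> {0}" "u ` (X closure_of C') \<subseteq> {1}"
      using Urysohn_lemma[OF nX, of "X closure_of C" "X closure_of C'" 0 1] by auto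
    have "N \<subseteq> X closure_of C" "N' \<subseteq> X closure_of C'"
      using N C C' by (meson closure_of_subset openin_subset subset_trans)+
    moreover have "continuous_map X euclideanreal u"
      using u(1) by (simp add: continuous_map_in_subtopology)
    ultimately have "sepf (N, N') u"
      using u(2,3) unfolding sepf_def fst_conv snd_conv by (meson image_mono subset_trans)
    then have p: "(N, N') \<in> I"
      using N by (auto simp: I_def)
    have "f (N, N') x = f (N, N') y"
      using xy(3) p by (metis h_def restrict_apply')
    then show False
      using f[OF p] N by (force simp: sepf_def)
  qed
  have Zm: "metrizable_space Z"
    unfolding Z_def metrizable_space_product_topology
    using countable_subset[OF _ cI] metrizable_space_euclidean by auto
  then have "Hausdorff_space Z"
    by (rule metrizable_imp_Hausdorff_space)
  then have "closed_map X Z h"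
    using X \<open>continuous_map X Z h\<close> continuous_imp_closed_map by blast
  then have "embedding_map X Z h"
    using \<open>continuous_map X Z h\<close> inj injective_closed_imp_embedding_map by blast
  then show ?thesis
    using homeomorphic_metrizable_space[OF embedding_map_imp_homeomorphic_space]
      metrizable_space_subtopology[OF Zm] by blast
qed

section \<open>Rectifiable spaces\<close>

text \<open>The two coordinate functions of a rectification and its inverse. In a topological group they are
  \<open>p x y = inverse x * y\<close> and \<open>q x y = x * y\<close>.\<close>

locale rectification =
  fixes G :: "'a topology" and e :: 'a and p q :: "'a \<Rightarrow> 'a \<Rightarrow> 'a"
  assumes unit_in: "e \<in> topspace G"
    and continuous_p: "continuous_map (prod_topology G G) G (\<lambda>z. p (fst z) (snd z))"
    and continuous_q: "continuous_map (prod_topology G G) G (\<lambda>z. q (fst z) (snd z))"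
    and p_diag: "x \<in> topspace G \<Longrightarrow> p x x = e"
    and q_p: "x \<in> topspace G \<Longrightarrow> y \<in> topspace G \<Longrightarrow> q x (p x y) = y"
    and p_q: "x \<in> topspace G \<Longrightarrow> y \<in> topspace G \<Longrightarrow> p x (q x y) = y"
begin

lemma continuous_p_right: "x \<in> topspace G \<Longrightarrow> continuous_map G G (p x)"
proof -
  assume "x \<in> topspace G"
  then have "continuous_map G (prod_topology G G) (\<lambda>y. (x, y))"
    by (auto simp: continuous_map_pairwise o_def)
  from continuous_map_compose[OF this continuous_p] show ?thesis
    by (simp add: o_def)
qed

lemma continuous_q_right: "x \<in> topspace G \<Longrightarrow> continuous_map G G (q x)"
proof -
  assume "x \<in> topspace G"
  then have "continuous_map G (prod_topology G G) (\<lambda>y. (x, y))"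
    by (auto simp: continuous_map_pairwise o_def)
  from continuous_map_compose[OF this continuous_q] show ?thesis
    by (simp add: o_def)
qed

lemma p_in: "x \<in> topspace G \<Longrightarrow> y \<in> topspace G \<Longrightarrow> p x y \<in> topspace G"
  using continuous_p_right[of x] by (auto simp: continuous_map_def)

lemma q_in: "x \<in> topspace G \<Longrightarrow> y \<in> topspace G \<Longrightarrow> q x y \<in> topspace G"
  using continuous_q_right[of x] by (auto simp: continuous_map_def)

lemma q_unit: "x \<in> topspace G \<Longrightarrow> q x e = x"
  using q_p[of x x] p_diag[of x] by simp

lemma homogeneous:
  assumes "x \<in> topspace G" "y \<in> topspace G"
  obtains h where "homeomorphic_map G G h" "h x = y"
proof
  have "homeomorphic_maps G G (q y \<circ> p x) (q x \<circ> p y)"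
    unfolding homeomorphic_maps_def
    using assms continuous_map_compose[OF continuous_p_right continuous_q_right]
    by (auto simp: p_in q_in p_q q_p)
  then show "homeomorphic_map G G (q y \<circ> p x)"
    using homeomorphic_maps_map by blast
  show "(q y \<circ> p x) x = y"
    using assms by (simp add: p_diag q_unit)
qed

lemma openin_p_preimage: "x \<in> topspace G \<Longrightarrow> openin G U \<Longrightarrow> openin G {y \<in> topspace G. p x y \<in> U}"
  using continuous_p_right openin_continuous_map_preimage by blast

lemma openin_q_preimage: "x \<in> topspace G \<Longrightarrow> openin G U \<Longrightarrow> openin G {y \<in> topspace G. q x y \<in> U}"
  using continuous_q_right openin_continuous_map_preimage by blast

lemma p_small:
  assumes "openin G W" "e \<in> W"
  obtains U where "openin G U" "e \<in> U" "\<And>x y. x \<in> U \<Longrightarrow> y \<in> U \<Longrightarrow> p x y \<in> W"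
proof -
  let ?P = "{z \<in> topspace (prod_topology G G). p (fst z) (snd z) \<in> W}"
  have "openin (prod_topology G G) ?P"
    using continuous_p assms(1) openin_continuous_map_preimage by blast
  moreover have "(e, e) \<in> ?P"
    using assms(2) unit_in p_diag by simp
  ultimately obtain U V where UV: "openin G U" "openin G V" "e \<in> U" "e \<in> V" "U \<times> V \<subseteq> ?P"
    unfolding openin_prod_topology_alt by meson
  show thesis
  proof (rule that[of "U \<inter> V"])
    fix x y assume "x \<in> U \<inter> V" "y \<in> U \<inter> V"
    then have "(x, y) \<in> ?P"
      using UV(5) by blast
    then show "p x y \<in> W"
      by simp
  qed (use UV in auto)
qed

text \<open>In a topological group, let a sequence of neighbourhoods of the unit be such that quotients of
  members of one set fall into the preceding set. The intersection is a subgroup, hence open as soon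
  as it has an interior point. The same happens here: if \<open>c\<close> is an interior point, the division \<open>p c\<close> moves a neighbourhood of \<open>c\<close> onto
  a neighbourhood of \<open>e\<close> and keeps it inside the intersection.\<close>

lemma P_space_if_countable_open_core:
  assumes core: "\<And>W. (\<And>n::nat. openin G (W n) \<and> e \<in> W n) \<Longrightarrow> \<exists>V. openin G V \<and> V \<noteq> {} \<and> (\<forall>n. V \<subseteq> W n)"
    and x: "x \<in> topspace G" and W: "\<And>n::nat. openin G (W n) \<and> x \<in> W n"
  shows "\<exists>V. openin G V \<and> x \<in> V \<and> (\<forall>n. V \<subseteq> W n)"
proof -
  define Wx where "Wx n = {y \<in> topspace G. q x y \<in> W n}" for n
  have Wx: "openin G (Wx n)" "e \<in> Wx n" for n
    using W x openin_q_preimage unit_in by (auto simp: Wx_def q_unit)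
  have "\<exists>U. \<forall>n. (openin G (U n) \<and> e \<in> U n \<and> U n \<subseteq> Wx n) \<and> (\<forall>y\<in>U (Suc n). \<forall>z\<in>U (Suc n). p y z \<in> U n)"
  proof (rule dependent_nat_choice)
    show "\<exists>U. openin G U \<and> e \<in> U \<and> U \<subseteq> Wx 0"
      using Wx by blast
    fix U n assume U: "openin G U \<and> e \<in> U \<and> U \<subseteq> Wx n"
    obtain U' where U': "openin G U'" "e \<in> U'" "\<And>y z. y \<in> U' \<Longrightarrow> z \<in> U' \<Longrightarrow> p y z \<in> U"
      using p_small[of U] U by metis
    show "\<exists>U'. (openin G U' \<and> e \<in> U' \<and> U' \<subseteq> Wx (Suc n)) \<and> (\<forall>y\<in>U'. \<forall>z\<in>U'. p y z \<in> U)"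
      by (rule exI[of _ "U' \<inter> Wx (Suc n)"]) (use U' Wx in auto)
  qed
  then obtain U where U: "\<And>n::nat. openin G (U n)" "\<And>n. e \<in> U n" "\<And>n. U n \<subseteq> Wx n"
      "\<And>n y z. y \<in> U (Suc n) \<Longrightarrow> z \<in> U (Suc n) \<Longrightarrow> p y z \<in> U n"
    by meson
  obtain C where C: "openin G C" "C \<noteq> {}" "\<And>n. C \<subseteq> U n"
    using core[of U] U by meson
  then obtain c where c: "c \<in> C"
    by auto
  have cG: "c \<in> topspace G"
    using C c openin_subset by blast
  \<comment> \<open>The homeomorphism \<open>q c \<circ> p x\<close> maps \<open>x\<close> to \<open>c\<close>, so \<open>V\<close> is a neighbourhood of \<open>x\<close>; applying \<open>p c\<close> to
    its image in \<open>C\<close> recovers \<open>p x y\<close>, one step up in the sequence \<open>U\<close>.\<close>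
  define V where "V = {y \<in> topspace G. q c (p x y) \<in> C}"
  have "openin G {y \<in> topspace G. p x y \<in> {w \<in> topspace G. q c w \<in> C}}"
    using x cG C by (intro openin_p_preimage openin_q_preimage)
  moreover have "{y \<in> topspace G. p x y \<in> {w \<in> topspace G. q c w \<in> C}} = V"
    using x p_in by (auto simp: V_def)
  ultimately have "openin G V"
    by simp
  moreover have "x \<in> V"
    using x c cG by (simp add: V_def p_diag q_unit)
  moreover have "V \<subseteq> W n" for n
  proof
    fix y assume y: "y \<in> V"
    then have yG: "y \<in> topspace G" and "q c (p x y) \<in> U (Suc n)" "c \<in> U (Suc n)"
      using C(3)[of "Suc n"] c by (auto simp: V_def)
    then have "p c (q c (p x y)) \<in> U n"
      using U(4) by blast
    then have "p x y \<in> Wx n"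
      using p_q[OF cG p_in[OF x yG]] U(3) by auto
    then show "y \<in> W n"
      using q_p[OF x yG] by (simp add: Wx_def)
  qed
  ultimately show ?thesis
    by blast
qed

text \<open>The group analogue is that the translates \<open>d * U n\<close> of a base at the unit form a base at all points
  of the closure of \<open>D\<close>. Take \<open>d\<close> so close to \<open>x\<close> that \<open>p d x\<close> is small, by the continuity of \<open>p\<close>
  at \<open>(x, x)\<close>, and that \<open>q d\<close> maps \<open>U n\<close> into \<open>V\<close>, by the continuity of \<open>q\<close> at \<open>(x, e)\<close>.\<close>

lemma base_from_dense_subset:
  assumes base: "\<And>V. openin G V \<Longrightarrow> e \<in> V \<Longrightarrow> \<exists>n::nat. U n \<subseteq> V"
    and U: "\<And>n. openin G (U n)" "\<And>n. e \<in> U n"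
    and x: "x \<in> G closure_of D" and V: "openin G V" "x \<in> V"
  shows "\<exists>d\<in>D. \<exists>n. p d x \<in> U n \<and> {y \<in> topspace G. p d y \<in> U n} \<subseteq> V"
proof -
  have xG: "x \<in> topspace G"
    using V openin_subset by blast
  let ?Q = "{z \<in> topspace (prod_topology G G). q (fst z) (snd z) \<in> V}"
  have "openin (prod_topology G G) ?Q"
    using continuous_q V(1) openin_continuous_map_preimage by blast
  moreover have "(x, e) \<in> ?Q"
    using V xG unit_in q_unit by simp
  ultimately obtain A B where AB: "openin G A" "openin G B" "x \<in> A" "e \<in> B" "A \<times> B \<subseteq> ?Q"
    unfolding openin_prod_topology_alt by meson
  obtain n where n: "U n \<subseteq> B"
    using base AB by blast
  let ?P = "{z \<in> topspace (prod_topology G G). p (fst z) (snd z) \<in> U n}"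
  have "openin (prod_topology G G) ?P"
    using continuous_p U(1) openin_continuous_map_preimage by blast
  moreover have "(x, x) \<in> ?P"
    using xG U(2) p_diag by simp
  ultimately obtain A' B' where AB': "openin G A'" "openin G B'" "x \<in> A'" "x \<in> B'" "A' \<times> B' \<subseteq> ?P"
    unfolding openin_prod_topology_alt by meson
  have "openin G (A \<inter> A')" "x \<in> A \<inter> A'"
    using AB AB' by auto
  then obtain d where d: "d \<in> D" "d \<in> A \<inter> A'"
    using x unfolding in_closure_of by blast
  then have dG: "d \<in> topspace G"
    using AB openin_subset by blast
  have "(d, x) \<in> ?P"
    using d AB' by blast
  moreover have "y \<in> V" if "y \<in> topspace G" "p d y \<in> U n" for y
  proof -
    have "(d, p d y) \<in> ?Q"
      using d n AB that by blast
    then show ?thesis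
      using q_p dG that by simp
  qed
  ultimately show ?thesis
    using d(1) by (intro bexI[of _ d] exI[of _ n]) auto
qed

end

lemma rectifiable_imp_rectification:
  assumes "rectifiable_space G"
  obtains e p q where "rectification G e p q"
proof -
  obtain e \<phi> where e: "e \<in> topspace G"
    and \<phi>: "homeomorphic_map (prod_topology G G) (prod_topology G G) \<phi>"
    and fst\<phi>: "\<And>z. z \<in> topspace (prod_topology G G) \<Longrightarrow> fst (\<phi> z) = fst z"
    and diag: "\<And>x. x \<in> topspace G \<Longrightarrow> \<phi> (x, x) = (x, e)"
    using assms unfolding rectifiable_space_def by metis
  obtain \<psi> where \<psi>: "homeomorphic_maps (prod_topology G G) (prod_topology G G) \<phi> \<psi>"
    using \<phi> homeomorphic_map_maps by blast
  then have cont: "continuous_map (prod_topology G G) (prod_topology G G) \<phi>"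
      "continuous_map (prod_topology G G) (prod_topology G G) \<psi>"
    and inv: "\<And>z. z \<in> topspace (prod_topology G G) \<Longrightarrow> \<psi> (\<phi> z) = z"
      "\<And>z. z \<in> topspace (prod_topology G G) \<Longrightarrow> \<phi> (\<psi> z) = z"
    unfolding homeomorphic_maps_def by auto
  have \<psi>in: "\<psi> z \<in> topspace (prod_topology G G)" if "z \<in> topspace (prod_topology G G)" for z
    using cont(2) that by (auto simp: continuous_map_def)
  have fst\<psi>: "fst (\<psi> z) = fst z" if "z \<in> topspace (prod_topology G G)" for z
    using fst\<phi>[OF \<psi>in[OF that]] inv(2)[OF that] by simp
  have \<phi>eq: "(x, snd (\<phi> (x, y))) = \<phi> (x, y)" and \<psi>eq: "(x, snd (\<psi> (x, y))) = \<psi> (x, y)"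
    if "x \<in> topspace G" "y \<in> topspace G" for x y
    using fst\<phi>[of "(x, y)"] fst\<psi>[of "(x, y)"] that by (simp_all add: prod_eq_iff)
  show thesis
  proof (rule that[of e "\<lambda>x y. snd (\<phi> (x, y))" "\<lambda>x y. snd (\<psi> (x, y))"], unfold_locales)
    show "continuous_map (prod_topology G G) G (\<lambda>z. snd (\<phi> (fst z, snd z)))"
      using continuous_map_compose[OF cont(1) continuous_map_snd] by (simp add: o_def)
    show "continuous_map (prod_topology G G) G (\<lambda>z. snd (\<psi> (fst z, snd z)))"
      using continuous_map_compose[OF cont(2) continuous_map_snd] by (simp add: o_def)
  qed (use e diag inv in \<open>simp_all add: \<phi>eq \<psi>eq\<close>)
qed

lemma homeomorphic_rectifiable_space:
  assumes "G homeomorphic_space H" "rectifiable_space G"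
  shows "rectifiable_space H"
proof -
  obtain f g where fg: "homeomorphic_maps G H f g"
    using assms(1) unfolding homeomorphic_space_def by blast
  then have fgy: "\<And>y. y \<in> topspace H \<Longrightarrow> f (g y) = y"
    and fin: "\<And>x. x \<in> topspace G \<Longrightarrow> f x \<in> topspace H" and gin: "\<And>x. x \<in> topspace H \<Longrightarrow> g x \<in> topspace G"
    by (auto simp: homeomorphic_maps_def continuous_map_def)
  obtain e \<phi> where e: "e \<in> topspace G"
    and \<phi>: "homeomorphic_map (prod_topology G G) (prod_topology G G) \<phi>"
    and fst\<phi>: "\<And>z. z \<in> topspace (prod_topology G G) \<Longrightarrow> fst (\<phi> z) = fst z"
    and diag: "\<And>x. x \<in> topspace G \<Longrightarrow> \<phi> (x, x) = (x, e)"
    using assms(2) unfolding rectifiable_space_def by metis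
  have F: "homeomorphic_map (prod_topology G G) (prod_topology H H) (\<lambda>(x, y). (f x, f y))"
    and K: "homeomorphic_map (prod_topology H H) (prod_topology G G) (\<lambda>(x, y). (g x, g y))"
    using fg homeomorphic_maps_prod[of G G H H f f g g] homeomorphic_maps_map by blast+
  define \<theta> where "\<theta> = (\<lambda>(x, y). (f x, f y)) \<circ> (\<phi> \<circ> (\<lambda>(x, y). (g x, g y)))"
  have "homeomorphic_map (prod_topology H H) (prod_topology H H) \<theta>"
    unfolding \<theta>_def using F K \<phi> by (intro homeomorphic_map_compose)
  moreover have "fst (\<theta> z) = fst z" if "z \<in> topspace (prod_topology H H)" for z
    using fst\<phi>[of "(g (fst z), g (snd z))"] that gin fgy
    by (auto simp: \<theta>_def split: prod.splits)
  moreover have "\<theta> (x, x) = (x, f e)" if "x \<in> topspace H" for x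
    using diag[of "g x"] that gin fgy by (simp add: \<theta>_def)
  ultimately show ?thesis
    unfolding rectifiable_space_def using fin[OF e] by blast
qed

section \<open>Points of suborderable spaces\<close>

text \<open>For the left side of a point \<open>s\<close>, the chain \<open>\<C>\<close> consists of the open rays above points \<open>a < s\<close>, and
  \<open>H\<close> is the set of all points below \<open>s\<close>; the right side is dual. A chain without a countable
  coinitial part has, below any sequence of its members, another member \<open>C\<close>, and \<open>C \<inter> H\<close> lies in all
  the given neighbourhoods. It is nonempty, since otherwise \<open>C\<close> alone would be coinitial.\<close>

lemma open_core_if_no_countable_side_base:
  assumes \<C>: "\<And>C. C \<in> \<C> \<Longrightarrow> openin X C \<and> s \<in> C"
      "\<And>C C'. C \<in> \<C> \<Longrightarrow> C' \<in> \<C> \<Longrightarrow> C \<subseteq> C' \<or> C' \<subseteq> C"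
    and H: "openin X H" "\<And>C. C \<in> \<C> \<Longrightarrow> topspace X - H \<subseteq> C"
    and nobase: "\<And>\<L>. countable \<L> \<Longrightarrow> (\<And>L. L \<in> \<L> \<Longrightarrow> openin X L \<and> s \<in> L) \<Longrightarrow> \<exists>C\<in>\<C>. \<forall>L\<in>\<L>. \<not> L \<subseteq> C"
    and base: "\<And>V. openin X V \<Longrightarrow> s \<in> V \<Longrightarrow> \<exists>C\<in>insert (topspace X) \<C>. C \<inter> H \<subseteq> V"
    and W: "\<And>n::nat. openin X (W n) \<and> s \<in> W n"
  shows "\<exists>V. openin X V \<and> V \<noteq> {} \<and> (\<forall>n. V \<subseteq> W n)"
proof -
  obtain C0 where C0: "C0 \<in> \<C>"
    using nobase[of "{}"] by auto
  have "\<exists>C\<in>\<C>. C \<inter> H \<subseteq> W n" for n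
  proof -
    obtain C where C: "C \<in> insert (topspace X) \<C>" "C \<inter> H \<subseteq> W n"
      using base W by meson
    show ?thesis
    proof (cases "C \<in> \<C>")
      case False
      then have "C0 \<inter> H \<subseteq> W n"
        using C \<C>(1)[OF C0] openin_subset by blast
      then show ?thesis
        using C0 by blast
    qed (use C in blast)
  qed
  then obtain c where c: "\<And>n. c n \<in> \<C>" "\<And>n. c n \<inter> H \<subseteq> W n"
    by metis
  obtain C where C: "C \<in> \<C>" "\<And>n. \<not> c n \<subseteq> C"
    using nobase[of "range c"] \<C>(1) c(1) by auto
  have "C \<inter> H \<subseteq> W n" for n
    using \<C>(2)[OF C(1) c(1)[of n]] C(2)[of n] c(2)[of n] by blast
  moreover have "openin X (C \<inter> H)"
    using \<C>(1) C(1) H(1) by blast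
  moreover have "C \<inter> H \<noteq> {}"
  proof
    assume "C \<inter> H = {}"
    then have "C \<subseteq> topspace X - H"
      using \<C>(1)[OF C(1)] openin_subset by blast
    then have "C \<subseteq> C'" if "C' \<in> \<C>" for C'
      using H(2)[OF that] by blast
    then show False
      using nobase[of "{C}"] \<C>(1)[OF C(1)] by auto
  qed
  ultimately show ?thesis
    by blast
qed

text \<open>Countable bases of the two sides of \<open>s\<close> combine to a countable base at \<open>s\<close>. If one side has none,
  any countably many neighbourhoods of \<open>s\<close> contain a common nonempty open piece of that side.\<close>

lemma suborderable_point_dichotomy:
  fixes S :: "'l::linorder_topology set"
  assumes s: "s \<in> S"
  defines "X \<equiv> top_of_set S"
  shows "(\<exists>U :: nat \<Rightarrow> 'l set. (\<forall>n. openin X (U n) \<and> s \<in> U n) \<and> (\<forall>V. openin X V \<and> s \<in> V \<longrightarrow> (\<exists>n. U n \<subseteq> V)))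
    \<or> (\<forall>W :: nat \<Rightarrow> 'l set. (\<forall>n. openin X (W n) \<and> s \<in> W n) \<longrightarrow> (\<exists>V. openin X V \<and> V \<noteq> {} \<and> (\<forall>n. V \<subseteq> W n)))"
proof -
  define \<A> where "\<A> = (\<lambda>a. S \<inter> {a<..}) ` {..<s}"
  define \<B> where "\<B> = (\<lambda>b. S \<inter> {..<b}) ` {s<..}"
  have X: "topspace X = S"
    by (simp add: X_def)
  have op: "openin X (S \<inter> U)" if "open U" for U
    using that by (auto simp: X_def openin_open)
  have \<A>: "openin X A \<and> s \<in> A" if "A \<in> \<A>" for A
    using that s by (auto simp: \<A>_def intro!: op)
  have \<B>: "openin X B \<and> s \<in> B" if "B \<in> \<B>" for B
    using that s by (auto simp: \<B>_def intro!: op)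
  have chainA: "A \<subseteq> A' \<or> A' \<subseteq> A" if AA: "A \<in> \<A>" "A' \<in> \<A>" for A A'
  proof -
    obtain a a' where "A = S \<inter> {a<..}" "A' = S \<inter> {a'<..}"
      using AA by (auto simp: \<A>_def)
    then show ?thesis
      by (cases "a \<le> a'") auto
  qed
  have chainB: "A \<subseteq> A' \<or> A' \<subseteq> A" if AA: "A \<in> \<B>" "A' \<in> \<B>" for A A'
  proof -
    obtain a a' where "A = S \<inter> {..<a}" "A' = S \<inter> {..<a'}"
      using AA by (auto simp: \<B>_def)
    then show ?thesis
      by (cases "a \<le> a'") auto
  qed
  have base: "\<exists>A\<in>insert S \<A>. \<exists>B\<in>insert S \<B>. A \<inter> B \<subseteq> V" if V: "openin X V" "s \<in> V" for V
  proof -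
    obtain O' where O: "open O'" "V = S \<inter> O'"
      using V(1) by (auto simp: X_def openin_open)
    have "\<exists>A\<in>insert S \<A>. A \<inter> {..s} \<subseteq> O'"
    proof (cases "\<exists>y. y < s")
      case True
      then obtain b where b: "b < s" "{b<..s} \<subseteq> O'"
        using open_left[OF O(1)] O(2) V(2) by blast
      then show ?thesis
        by (intro bexI[of _ "S \<inter> {b<..}"]) (auto simp: \<A>_def)
    next
      case False
      then have "{..s} = {s}"
        by (auto simp: order.order_iff_strict)
      then show ?thesis
        using V(2) O(2) by (intro bexI[of _ S]) auto
    qed
    moreover have "\<exists>B\<in>insert S \<B>. B \<inter> {s..} \<subseteq> O'"
    proof (cases "\<exists>y. s < y")
      case True
      then obtain b where b: "s < b" "{s..<b} \<subseteq> O'"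
        using open_right[OF O(1)] O(2) V(2) by blast
      then show ?thesis
        by (intro bexI[of _ "S \<inter> {..<b}"]) (auto simp: \<B>_def)
    next
      case False
      then have "{s..} = {s}"
        by (auto simp: order.order_iff_strict)
      then show ?thesis
        using V(2) O(2) by (intro bexI[of _ S]) auto
    qed
    ultimately obtain A B where AB: "A \<in> insert S \<A>" "A \<inter> {..s} \<subseteq> O'" "B \<in> insert S \<B>" "B \<inter> {s..} \<subseteq> O'"
      by blast
    have "A \<inter> B \<subseteq> V"
    proof
      fix x assume x: "x \<in> A \<inter> B"
      have "A \<subseteq> S"
        using AB(1) by (auto simp: \<A>_def)
      moreover have "x \<le> s \<or> s \<le> x"
        by (rule linear)
      ultimately show "x \<in> V"
        using AB(2,4) x O(2) by auto
    qed
    then show ?thesis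
      using AB by blast
  qed
  have leftH: "openin X (S \<inter> {..<s})" "\<And>A. A \<in> \<A> \<Longrightarrow> topspace X - S \<inter> {..<s} \<subseteq> A"
     "\<And>B. B \<in> insert S \<B> \<Longrightarrow> S \<inter> {..<s} \<subseteq> B"
    by (auto simp: \<A>_def \<B>_def X intro!: op)
  have rightH: "openin X (S \<inter> {s<..})" "\<And>B. B \<in> \<B> \<Longrightarrow> topspace X - S \<inter> {s<..} \<subseteq> B"
     "\<And>A. A \<in> insert S \<A> \<Longrightarrow> S \<inter> {s<..} \<subseteq> A"
    by (auto simp: \<A>_def \<B>_def X intro!: op)
  have lbase: "\<exists>A\<in>insert (topspace X) \<A>. A \<inter> (S \<inter> {..<s}) \<subseteq> V" if V: "openin X V" "s \<in> V" for V
  proof -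
    obtain A B where "A \<in> insert S \<A>" "B \<in> insert S \<B>" "A \<inter> B \<subseteq> V"
      using base[OF V] by blast
    then have "A \<inter> (S \<inter> {..<s}) \<subseteq> V"
      using leftH(3)[of B] by blast
    then show ?thesis
      using \<open>A \<in> insert S \<A>\<close> X by blast
  qed
  have rbase: "\<exists>B\<in>insert (topspace X) \<B>. B \<inter> (S \<inter> {s<..}) \<subseteq> V" if V: "openin X V" "s \<in> V" for V
  proof -
    obtain A B where "A \<in> insert S \<A>" "B \<in> insert S \<B>" "A \<inter> B \<subseteq> V"
      using base[OF V] by blast
    then have "B \<inter> (S \<inter> {s<..}) \<subseteq> V"
      using rightH(3)[of A] by blast
    then show ?thesis
      using \<open>B \<in> insert S \<B>\<close> X by blast
  qed
  define sb where "sb \<L> \<C> \<longleftrightarrow> countable \<L> \<and> (\<forall>L\<in>\<L>. openin X L \<and> s \<in> L) \<and> (\<forall>C\<in>\<C>. \<exists>L\<in>\<L>. L \<subseteq> C)"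
    for \<L> \<C> :: "'l set set"
  consider (both) \<L> \<R> where "sb \<L> \<A>" "sb \<R> \<B>" | (left) "\<nexists>\<L>. sb \<L> \<A>" | (right) "\<nexists>\<R>. sb \<R> \<B>"
    by blast
  then show ?thesis
  proof cases
    case both
    define \<U> where "\<U> = (\<lambda>(L, R). L \<inter> R) ` (insert S \<L> \<times> insert S \<R>)"
    have "countable \<U>" "\<U> \<noteq> {}"
      using both by (auto simp: \<U>_def sb_def)
    then have mem: "from_nat_into \<U> n \<in> \<U>" and ran: "U \<in> \<U> \<Longrightarrow> \<exists>n. from_nat_into \<U> n = U" for n U
      by (auto intro: from_nat_into from_nat_into_surj)
    have "openin X S"
      using X by (metis openin_topspace)
    then have opU: "openin X U \<and> s \<in> U" if "U \<in> \<U>" for U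
      using that both s by (auto simp: \<U>_def sb_def)
    have sub: "\<exists>U\<in>\<U>. U \<subseteq> V" if V: "openin X V" "s \<in> V" for V
    proof -
      obtain A B where AB: "A \<in> insert S \<A>" "B \<in> insert S \<B>" "A \<inter> B \<subseteq> V"
        using base[OF V] by blast
      obtain L where "L \<in> insert S \<L>" "L \<subseteq> A"
        using AB(1) both(1) unfolding sb_def by blast
      moreover obtain R where "R \<in> insert S \<R>" "R \<subseteq> B"
        using AB(2) both(2) unfolding sb_def by blast
      ultimately have "L \<inter> R \<in> \<U>" "L \<inter> R \<subseteq> V"
        using AB(3) by (auto simp: \<U>_def)
      then show ?thesis ..
    qed
    show ?thesis
    proof (intro disjI1 exI[of _ "from_nat_into \<U>"] conjI allI impI)
      show "openin X (from_nat_into \<U> n)" "s \<in> from_nat_into \<U> n" for n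
        using opU[OF mem] by auto
      show "\<exists>n. from_nat_into \<U> n \<subseteq> V" if "openin X V \<and> s \<in> V" for V
        using sub[of V] ran that by metis
    qed
  next
    case left
    have nobase: "\<exists>C\<in>\<A>. \<forall>L\<in>\<L>. \<not> L \<subseteq> C"
      if "countable \<L>" "\<And>L. L \<in> \<L> \<Longrightarrow> openin X L \<and> s \<in> L" for \<L>
    proof (rule ccontr)
      assume "\<not> ?thesis"
      then have "sb \<L> \<A>"
        using that unfolding sb_def by simp
      then show False
        using left by simp
    qed
    have "\<exists>V. openin X V \<and> V \<noteq> {} \<and> (\<forall>n. V \<subseteq> W n)"
      if W: "\<And>n::nat. openin X (W n) \<and> s \<in> W n" for W
      by (rule open_core_if_no_countable_side_base[OF \<A> chainA leftH(1,2) nobase lbase W])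
    then show ?thesis
      by blast
  next
    case right
    have nobase: "\<exists>C\<in>\<B>. \<forall>L\<in>\<L>. \<not> L \<subseteq> C"
      if "countable \<L>" "\<And>L. L \<in> \<L> \<Longrightarrow> openin X L \<and> s \<in> L" for \<L>
    proof (rule ccontr)
      assume "\<not> ?thesis"
      then have "sb \<L> \<B>"
        using that unfolding sb_def by simp
      then show False
        using right by simp
    qed
    have "\<exists>V. openin X V \<and> V \<noteq> {} \<and> (\<forall>n. V \<subseteq> W n)"
      if W: "\<And>n::nat. openin X (W n) \<and> s \<in> W n" for W
      by (rule open_core_if_no_countable_side_base[OF \<B> chainB rightH(1,2) nobase rbase W])
    then show ?thesis
      by blast
  qed
qed

lemma GO_space_point_dichotomy:
  assumes "GO_space TYPE('l::linorder_topology) G" and x: "x \<in> topspace G"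
  obtains (countable_base) U where "\<And>n::nat. openin G (U n)" "\<And>n. x \<in> U n"
      "\<And>V. openin G V \<Longrightarrow> x \<in> V \<Longrightarrow> \<exists>n. U n \<subseteq> V"
  | (open_core) "\<And>W. (\<And>n::nat. openin G (W n) \<and> x \<in> W n) \<Longrightarrow> \<exists>V. openin G V \<and> V \<noteq> {} \<and> (\<forall>n. V \<subseteq> W n)"
proof -
  obtain S :: "'l set" where "G homeomorphic_space top_of_set S"
    using assms(1) unfolding GO_space_def by blast
  then obtain f g where fg: "homeomorphic_maps G (top_of_set S) f g"
    unfolding homeomorphic_space_def by blast
  have f: "continuous_map G (top_of_set S) f" and g: "continuous_map (top_of_set S) G g"
    and gf: "\<And>x. x \<in> topspace G \<Longrightarrow> g (f x) = x" and fS: "\<And>x. x \<in> topspace G \<Longrightarrow> f x \<in> S"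
    and gG: "\<And>y. y \<in> S \<Longrightarrow> g y \<in> topspace G" and fgy: "\<And>y. y \<in> S \<Longrightarrow> f (g y) = y"
    using fg by (auto simp: homeomorphic_maps_def continuous_map_def)
  have fop: "openin G {z \<in> topspace G. f z \<in> V}" if "openin (top_of_set S) V" for V
    using openin_continuous_map_preimage[OF f that] .
  have gop: "openin (top_of_set S) {y \<in> S. g y \<in> V}" if "openin G V" for V
    using openin_continuous_map_preimage[OF g that] by simp
  from suborderable_point_dichotomy[OF fS[OF x]] show thesis
  proof (elim disjE exE conjE)
    fix U :: "nat \<Rightarrow> 'l set"
    assume U: "\<forall>n. openin (top_of_set S) (U n) \<and> f x \<in> U n"
      and base: "\<forall>V. openin (top_of_set S) V \<and> f x \<in> V \<longrightarrow> (\<exists>n. U n \<subseteq> V)"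
    show thesis
    proof (rule countable_base[of "\<lambda>n. {z \<in> topspace G. f z \<in> U n}"])
      fix V assume V: "openin G V" "x \<in> V"
      then have "f x \<in> {y \<in> S. g y \<in> V}"
        using x fS gf by simp
      then obtain n where "U n \<subseteq> {y \<in> S. g y \<in> V}"
        using base gop V(1) by meson
      then have "{z \<in> topspace G. f z \<in> U n} \<subseteq> V"
        using gf by force
      then show "\<exists>n. {z \<in> topspace G. f z \<in> U n} \<subseteq> V" ..
    qed (use U x fop in auto)
  next
    assume core: "\<forall>W :: nat \<Rightarrow> 'l set. (\<forall>n. openin (top_of_set S) (W n) \<and> f x \<in> W n) \<longrightarrow>
      (\<exists>V. openin (top_of_set S) V \<and> V \<noteq> {} \<and> (\<forall>n. V \<subseteq> W n))"
    show thesis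
    proof (rule open_core)
      fix W assume W: "\<And>n::nat. openin G (W n) \<and> x \<in> W n"
      then have "\<forall>n. openin (top_of_set S) {y \<in> S. g y \<in> W n} \<and> f x \<in> {y \<in> S. g y \<in> W n}"
        using gop x fS gf by simp
      then obtain V where V: "openin (top_of_set S) V" "V \<noteq> {}" "\<forall>n. V \<subseteq> {y \<in> S. g y \<in> W n}"
        using core[rule_format, of "\<lambda>n. {y \<in> S. g y \<in> W n}"] by blast
      obtain v where "v \<in> V"
        using V by blast
      then have "v \<in> S"
        using V(3) by blast
      then have "g v \<in> {z \<in> topspace G. f z \<in> V}"
        using \<open>v \<in> V\<close> gG fgy by simp
      moreover have "{z \<in> topspace G. f z \<in> V} \<subseteq> W n" for n
        using V(3) gf by force
      ultimately show "\<exists>V. openin G V \<and> V \<noteq> {} \<and> (\<forall>n. V \<subseteq> W n)"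
        using fop[OF V(1)] by blast
    qed
  qed
qed

section \<open>Traces of point-countable p-metabases\<close>

text \<open>A point-countable p-metabase of the subspace \<open>M\<close>, with neighbourhoods taken in \<open>X\<close> and without
  the requirement that members lie in \<open>M\<close>. In this form it passes to subsets of \<open>M\<close> unchanged.\<close>

definition trace_metabase :: "'a topology \<Rightarrow> 'a set \<Rightarrow> 'a set set \<Rightarrow> bool" where
  "trace_metabase X M \<P> \<longleftrightarrow>
    (\<forall>x\<in>M. countable {P \<in> \<P>. x \<in> P}) \<and>
    (\<forall>x\<in>M. \<forall>z\<in>M. x \<noteq> z \<longrightarrow>
      (\<exists>W F. openin X W \<and> x \<in> W \<and> finite F \<and> F \<subseteq> \<P> \<and> W \<inter> M \<subseteq> \<Union>F \<and> z \<notin> \<Union>F))"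

lemma trace_metabaseD:
  assumes "trace_metabase X M \<P>"
  shows "x \<in> M \<Longrightarrow> countable {P \<in> \<P>. x \<in> P}"
    and "x \<in> M \<Longrightarrow> z \<in> M \<Longrightarrow> x \<noteq> z \<Longrightarrow>
      \<exists>W F. openin X W \<and> x \<in> W \<and> finite F \<and> F \<subseteq> \<P> \<and> W \<inter> M \<subseteq> \<Union>F \<and> z \<notin> \<Union>F"
  using assms unfolding trace_metabase_def by simp_all

lemma trace_metabase_if_point_countable_p_metabase:
  assumes "has_point_countable_p_metabase (subtopology X N)" "N \<subseteq> topspace X" "M \<subseteq> N"
  obtains \<P> where "trace_metabase X M \<P>"
proof -
  have N: "topspace (subtopology X N) = N"
    using assms(2) by auto
  obtain \<P> where p: "p_metabase (subtopology X N) \<P>" and c: "point_countable (subtopology X N) \<P>"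
    using assms(1) unfolding has_point_countable_p_metabase_def by meson
  have "\<exists>W F. openin X W \<and> x \<in> W \<and> finite F \<and> F \<subseteq> \<P> \<and> W \<inter> M \<subseteq> \<Union>F \<and> z \<notin> \<Union>F"
    if xz: "x \<in> M" "z \<in> M" "x \<noteq> z" for x z
  proof -
    have "x \<in> N" "z \<in> N"
      using xz assms(3) by auto
    then obtain F where F: "finite F" "F \<subseteq> \<P>" "x \<in> subtopology X N interior_of \<Union>F"
      "\<Union>F \<subseteq> N - {z}"
      using p xz(3) unfolding p_metabase_def N by meson
    have "openin (subtopology X N) (subtopology X N interior_of \<Union>F)"
      by simp
    then obtain W where W: "openin X W" "subtopology X N interior_of \<Union>F = W \<inter> N"
      unfolding openin_subtopology by blast
    have "W \<inter> N \<subseteq> \<Union>F"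
      using W(2) interior_of_subset by metis
    then show ?thesis
      using F W assms(3) by (intro exI[of _ W] exI[of _ F]) auto
  qed
  then have "trace_metabase X M \<P>"
    using c assms(3) unfolding trace_metabase_def point_countable_def N by auto
  then show thesis
    by (rule that)
qed

text \<open>For points of the closure of \<open>D\<close> inside \<open>M\<close>, only those members of a separating finite family matter
  that meet \<open>D\<close>, and by point-countability the set \<open>D\<close> has only countably many of them. The open sets
  from \<open>T\<close> take care of the points of the closure outside \<open>M\<close>.\<close>

lemma separable_subset_of_trace_metabase:
  assumes X: "compact_space X" and M: "M \<subseteq> topspace X" "trace_metabase X M \<P>" and A: "A \<subseteq> M"
    and T: "\<And>d. d \<in> A \<Longrightarrow> countable (T d)"
    and outside: "\<And>D x z. \<lbrakk>countable D; D \<subseteq> A; x \<in> X closure_of D; x \<notin> M; z \<in> A\<rbrakk>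
       \<Longrightarrow> \<exists>W\<in>\<Union>d\<in>D. T d. openin X W \<and> x \<in> W \<and> z \<notin> W"
  obtains D where "countable D" "D \<subseteq> A" "A \<subseteq> X closure_of D"
proof (rule compact_separable_by_closing_off[OF X])
  show "A \<subseteq> topspace X"
    using M A by blast
  show "countable ({P \<in> \<P>. a \<in> P} \<union> T a)" if "a \<in> A" for a
    using T trace_metabaseD(1)[OF M(2), of a] A that by (intro countable_Un) blast+
  fix D x z
  assume D: "countable D" "D \<subseteq> A" and x: "x \<in> X closure_of D" and z: "z \<in> A" "z \<notin> X closure_of D"
  show "\<exists>W F. openin X W \<and> x \<in> W \<and> finite F \<and> F \<subseteq> (\<Union>d\<in>D. {P \<in> \<P>. d \<in> P} \<union> T d)
      \<and> W \<inter> D \<subseteq> \<Union>F \<and> z \<notin> \<Union>F"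
  proof (cases "x \<in> M")
    case True
    moreover have "z \<in> M" "x \<noteq> z"
      using z x A by auto
    ultimately obtain W F where WF: "openin X W" "x \<in> W" "finite F" "F \<subseteq> \<P>" "W \<inter> M \<subseteq> \<Union>F" "z \<notin> \<Union>F"
      using trace_metabaseD(2)[OF M(2)] by meson
    have "W \<inter> D \<subseteq> \<Union>{P \<in> F. P \<inter> D \<noteq> {}}"
    proof
      fix d assume d: "d \<in> W \<inter> D"
      then have "d \<in> W \<inter> M"
        using D(2) A by blast
      then obtain P where "P \<in> F" "d \<in> P"
        using WF(5) by blast
      then show "d \<in> \<Union>{P \<in> F. P \<inter> D \<noteq> {}}"
        using d by blast
    qed
    then show ?thesis
      using WF by (intro exI[of _ W] exI[of _ "{P \<in> F. P \<inter> D \<noteq> {}}"]) auto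
  next
    case False
    then obtain W where "W \<in> (\<Union>d\<in>D. T d)" "openin X W" "x \<in> W" "z \<notin> W"
      using outside[OF D x _ z(1)] by blast
    then show ?thesis
      by (intro exI[of _ W] exI[of _ "{W}"]) auto
  qed
qed (use that in blast)

lemma local_trace_metabase:
  assumes X: "regular_space X" and Y: "Y \<subseteq> topspace X"
    and loc: "has_locally has_point_countable_p_metabase (subtopology X Y)" and y: "y \<in> Y"
  obtains V \<P> where "openin X V" "y \<in> V" "trace_metabase X (X closure_of V \<inter> Y) \<P>"
proof -
  have TY: "topspace (subtopology X Y) = Y"
    using Y by auto
  obtain U N where U: "openin (subtopology X Y) U" "y \<in> U" "U \<subseteq> N" "N \<subseteq> Y"
    and N: "has_point_countable_p_metabase (subtopology (subtopology X Y) N)"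
    using loc y unfolding has_locally_def TY by metis
  have NX: "has_point_countable_p_metabase (subtopology X N)"
    using N U(4) by (simp add: subtopology_subtopology Int_absorb1)
  obtain O' where O: "openin X O'" "U = O' \<inter> Y"
    using U(1) unfolding openin_subtopology by (elim exE conjE)
  then have "y \<in> O'"
    using U(2) by simp
  then obtain V where V: "openin X V" "y \<in> V" "X closure_of V \<subseteq> O'"
    using regular_space_closure_nbhd[OF X O(1)] by metis
  have "X closure_of V \<inter> Y \<subseteq> N"
    using V(3) O(2) U(3) by auto
  then obtain \<P> where "trace_metabase X (X closure_of V \<inter> Y) \<P>"
    using trace_metabase_if_point_countable_p_metabase[OF NX subset_trans[OF U(4) Y]] by metis
  then show thesis
    using that V(1,2) by metis
qed

section \<open>Compact spaces with a dense and codense subset\<close>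

locale dense_codense =
  fixes X :: "'a topology" and S :: "'a set"
  assumes compact: "compact_space X" and Hausdorff: "Hausdorff_space X" and S_sub: "S \<subseteq> topspace X"
    and dense: "X closure_of S = topspace X" and codense: "X closure_of (topspace X - S) = topspace X"
begin

lemma regular: "regular_space X"
  using compact Hausdorff compact_Hausdorff_imp_regular_space by blast

lemma open_sub_closure_Int_dense:
  assumes "openin X V" "X closure_of E = topspace X"
  shows "V \<subseteq> X closure_of (V \<inter> E)"
  using openin_Int_closure_of_subset[OF assms(1), of E] openin_subset[OF assms(1)] assms(2) by auto

lemma open_minus_point: "openin X (topspace X - {z})"
  using Hausdorff_imp_t1_space[OF Hausdorff] closedin_t1_singleton[of X z]
  by (cases "z \<in> topspace X") (auto simp: openin_diff)

text \<open>A point of \<open>S\<close> has, for each \<open>d \<in> D\<close>, a neighbourhood whose closure misses \<open>d\<close>. In a P-space these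
  have a common neighbourhood, and by density its open extension to \<open>X\<close> stays in all the closures.\<close>

lemma countable_closure_avoids_P_space:
  assumes P: "\<And>x W. x \<in> S \<Longrightarrow> (\<And>n::nat. openin (subtopology X S) (W n) \<and> x \<in> W n)
      \<Longrightarrow> \<exists>V. openin (subtopology X S) V \<and> x \<in> V \<and> (\<forall>n. V \<subseteq> W n)"
    and D: "countable D" "D \<subseteq> topspace X - S"
  shows "X closure_of D \<inter> S = {}"
proof (rule ccontr)
  assume "X closure_of D \<inter> S \<noteq> {}"
  then obtain x where x: "x \<in> X closure_of D" "x \<in> S"
    by blast
  have xX: "x \<in> topspace X"
    using x(2) S_sub by blast
  have "D \<noteq> {}"
    using x(1) by auto
  have "\<exists>U. openin X U \<and> x \<in> U \<and> d \<notin> X closure_of U" if d: "d \<in> D" for d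
  proof -
    have "x \<noteq> d"
      using d D x by blast
    then have "openin X (topspace X - {d})" "x \<in> topspace X - {d}"
      using open_minus_point[of d] xX by auto
    then obtain U where "openin X U" "x \<in> U" "X closure_of U \<subseteq> topspace X - {d}"
      using regular_space_closure_nbhd[OF regular] by metis
    then show ?thesis
      by blast
  qed
  then obtain U where U: "\<And>d. d \<in> D \<Longrightarrow> openin X (U d) \<and> x \<in> U d \<and> d \<notin> X closure_of (U d)"
    by metis
  have fn: "from_nat_into D n \<in> D" for n
    using \<open>D \<noteq> {}\<close> by (rule from_nat_into)
  have UD: "openin (subtopology X S) (U (from_nat_into D n) \<inter> S) \<and> x \<in> U (from_nat_into D n) \<inter> S" for n
    using U[OF fn] x(2) by (auto simp: openin_subtopology)
  have "\<exists>V. openin (subtopology X S) V \<and> x \<in> V \<and> (\<forall>n. V \<subseteq> U (from_nat_into D n) \<inter> S)"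
    by (rule P[OF x(2) UD])
  then obtain V where V: "openin (subtopology X S) V" "x \<in> V"
      "\<forall>n. V \<subseteq> U (from_nat_into D n) \<inter> S"
    by (elim exE conjE)
  then obtain O' where O: "openin X O'" "V = O' \<inter> S"
    unfolding openin_subtopology by blast
  have "O' \<inter> D = {}"
  proof (rule ccontr)
    assume "O' \<inter> D \<noteq> {}"
    then obtain d where d: "d \<in> D" "d \<in> O'"
      by blast
    obtain n where n: "from_nat_into D n = d"
      using from_nat_into_surj[OF D(1) d(1)] by blast
    have "d \<in> X closure_of (O' \<inter> S)"
      using open_sub_closure_Int_dense[OF O(1) dense] d(2) by blast
    moreover have "X closure_of (O' \<inter> S) \<subseteq> X closure_of (U d)"
      using V(3)[rule_format, of n] O(2) n by (intro closure_of_mono) auto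
    ultimately show False
      using U[OF d(1)] by blast
  qed
  moreover have "x \<in> O'"
    using V(2) O(2) by blast
  ultimately show False
    using x(1) O(1) unfolding in_closure_of by blast
qed

text \<open>Closures of countable subsets of the remainder stay in it, so a closed neighbourhood in the
  remainder is separable, hence compact. By codensity, this makes \<open>V\<close> a nonempty open set that
  misses \<open>S\<close>.\<close>

lemma not_P_space_if_local_trace_metabase:
  assumes countable_closure: "\<And>D. countable D \<Longrightarrow> D \<subseteq> topspace X - S \<Longrightarrow> X closure_of D \<inter> S = {}"
    and V: "openin X V" "V \<noteq> {}" and M: "trace_metabase X (X closure_of V - S) \<P>"
  shows False
proof -
  let ?M = "X closure_of V - S"
  have clX: "X closure_of V \<subseteq> topspace X"
    by (rule closure_of_subset_topspace)
  have MX: "?M \<subseteq> topspace X"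
    using clX by blast
  obtain D where D: "countable D" "D \<subseteq> ?M" "?M \<subseteq> X closure_of D"
  proof (rule separable_subset_of_trace_metabase[OF compact MX M order_refl, of "\<lambda>_. {}"])
    fix D x z assume D: "countable D" "D \<subseteq> ?M" "x \<in> X closure_of D" "x \<notin> ?M" "z \<in> ?M"
    have "X closure_of D \<inter> S = {}"
      using D MX by (intro countable_closure) auto
    moreover have "X closure_of D \<subseteq> X closure_of V"
      using D(2) by (intro closure_of_minimal) auto
    ultimately show "\<exists>W\<in>\<Union>d\<in>D. {}. openin X W \<and> x \<in> W \<and> z \<notin> W"
      using D(3,4) by blast
  qed auto
  have DS: "X closure_of D \<inter> S = {}"
    using D MX by (intro countable_closure) auto
  have "V \<inter> (topspace X - S) \<subseteq> ?M"
    using closure_of_subset[OF openin_subset[OF V(1)]] by blast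
  then have "X closure_of (V \<inter> (topspace X - S)) \<subseteq> X closure_of D"
    using D(3) by (intro closure_of_minimal) auto
  then have "V \<subseteq> X closure_of D"
    using open_sub_closure_Int_dense[OF V(1) codense] by blast
  then have "V \<inter> S = {}"
    using DS by blast
  then have "V \<subseteq> X closure_of {}"
    using open_sub_closure_Int_dense[OF V(1) dense] by simp
  then show False
    using V(2) by simp
qed

end

section \<open>First countable rectifiable subspaces\<close>

text \<open>What is left of first countability and rectifiability of \<open>S\<close>: each point carries countably many
  open sets of \<open>X\<close>, and those of the points of \<open>D\<close> contain a base at every point of \<open>S\<close> in the closure
  of \<open>D\<close>.\<close>

locale closure_based = dense_codense +
  fixes B :: "'a \<Rightarrow> 'a set set"
  assumes countable_B: "d \<in> S \<Longrightarrow> countable (B d)"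
    and open_B: "d \<in> S \<Longrightarrow> W \<in> B d \<Longrightarrow> openin X W"
    and base_B: "\<lbrakk>D \<subseteq> S; x \<in> S; x \<in> X closure_of D; openin X U; x \<in> U\<rbrakk>
      \<Longrightarrow> \<exists>d\<in>D. \<exists>W\<in>B d. x \<in> W \<and> W \<subseteq> U"
begin

lemma avoiding_B:
  assumes D: "D \<subseteq> S" and x: "x \<in> S" "x \<in> X closure_of D" "x \<noteq> z"
  shows "\<exists>W\<in>\<Union>d\<in>D. B d. openin X W \<and> x \<in> W \<and> z \<notin> W"
proof -
  have "x \<in> topspace X"
    using x(1) S_sub by (rule subsetD[rotated])
  then obtain d W where "d \<in> D" "W \<in> B d" "x \<in> W" "W \<subseteq> topspace X - {z}"
    using base_B[OF D x(1,2) open_minus_point[of z]] x(3) by auto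
  then show ?thesis
    using open_B[of d W] D by blast
qed

lemma separable_if_closed_in_S:
  assumes A: "A \<subseteq> S" and clo: "\<And>D. countable D \<Longrightarrow> D \<subseteq> A \<Longrightarrow> X closure_of D \<subseteq> S"
  obtains D where "countable D" "D \<subseteq> A" "A \<subseteq> X closure_of D"
proof (rule compact_separable_by_closing_off[OF compact])
  show "A \<subseteq> topspace X"
    using A S_sub by (rule subset_trans)
  show "countable (B a)" if "a \<in> A" for a
    using that A by (intro countable_B) (rule subsetD)
  fix D x z
  assume D: "countable D" "D \<subseteq> A" and x: "x \<in> X closure_of D" and z: "z \<in> A" "z \<notin> X closure_of D"
  have "D \<subseteq> S" "x \<in> S" "x \<noteq> z"
    using D(2) A clo[OF D] x z by auto
  then obtain W where "W \<in> (\<Union>d\<in>D. B d)" "openin X W" "x \<in> W" "z \<notin> W"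
    using avoiding_B[of D x z] x by auto
  then show "\<exists>W F. openin X W \<and> x \<in> W \<and> finite F \<and> F \<subseteq> (\<Union>d\<in>D. B d) \<and> W \<inter> D \<subseteq> \<Union>F \<and> z \<notin> \<Union>F"
    by (intro exI[of _ W] exI[of _ "{W}"]) auto
qed (use that in blast)

text \<open>Otherwise closures of countable subsets of \<open>S\<close> near a given point would stay in \<open>S\<close>. Then
  \<open>S\<close> would be separable near that point, and a neighbourhood of it would lie in the closure of
  a countable subset of \<open>S\<close>, hence miss the remainder, against codensity.\<close>

lemma countably_approachable_dense:
  assumes V: "openin X V" "V \<noteq> {}"
  shows "\<exists>y\<in>V - S. \<exists>E. countable E \<and> E \<subseteq> S \<and> y \<in> X closure_of E"
proof (rule ccontr)
  assume contra: "\<not> ?thesis"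
  obtain v where v: "v \<in> V"
    using V(2) by blast
  obtain V' where V': "openin X V'" "v \<in> V'" "X closure_of V' \<subseteq> V"
    using regular_space_closure_nbhd[OF regular V(1) v] by metis
  have "X closure_of D \<subseteq> S" if D: "countable D" "D \<subseteq> V' \<inter> S" for D
  proof
    fix x assume x: "x \<in> X closure_of D"
    have "D \<subseteq> V'" "D \<subseteq> S"
      using D(2) by auto
    then have "X closure_of D \<subseteq> X closure_of V'"
      by (intro closure_of_mono)
    then have "x \<in> V"
      using x V'(3) by (meson subsetD)
    then show "x \<in> S"
      using contra D(1) \<open>D \<subseteq> S\<close> x by (meson DiffI)
  qed
  from separable_if_closed_in_S[OF Int_lower2 this]
  obtain D where D: "countable D" "D \<subseteq> V' \<inter> S" "V' \<inter> S \<subseteq> X closure_of D"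
    by metis
  have "X closure_of (V' \<inter> S) \<subseteq> X closure_of D"
    using D(3) by (intro closure_of_minimal) auto
  then have sub: "V' \<subseteq> X closure_of D"
    using open_sub_closure_Int_dense[OF V'(1) dense] by (rule subset_trans[rotated])
  have "v \<in> X closure_of (topspace X - S)"
    using codense V'(1,2) openin_subset by blast
  then obtain y where y: "y \<in> V'" "y \<in> topspace X - S"
    using V'(1,2) unfolding in_closure_of by meson
  have "V' \<subseteq> V"
    using closure_of_subset[OF openin_subset[OF V'(1)]] V'(3) by (rule subset_trans)
  then show False
    using contra D(1,2) y sub by (meson DiffD2 DiffI Int_subset_iff subsetD)
qed

text \<open>Separability is proved for the set \<open>Y\<close> of those points of \<open>V - S\<close> that lie in closures of
  countable subsets of \<open>S\<close>. For a countable subset \<open>D\<close> of it, a countable \<open>E \<subseteq> S\<close> has \<open>D\<close> in its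
  closure, so the sets attached to \<open>E\<close> form a base at the points of \<open>S\<close> in the closure of \<open>D\<close>.\<close>

lemma countably_approachable_open_set:
  assumes V: "openin X V" and M: "trace_metabase X (X closure_of V - S) \<P>"
  obtains E where "countable E" "E \<subseteq> S" "V \<subseteq> X closure_of E"
proof -
  define Y where "Y = {y \<in> V - S. \<exists>E. countable E \<and> E \<subseteq> S \<and> y \<in> X closure_of E}"
  have "\<forall>y\<in>Y. \<exists>E. countable E \<and> E \<subseteq> S \<and> y \<in> X closure_of E"
    by (simp add: Y_def)
  then obtain E where E: "\<And>y. y \<in> Y \<Longrightarrow> countable (E y) \<and> E y \<subseteq> S \<and> y \<in> X closure_of (E y)"
    by metis
  have VX: "V \<subseteq> topspace X"
    using V by (rule openin_subset)
  have VclV: "V \<subseteq> X closure_of V"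
    using VX by (rule closure_of_subset)
  have clE: "X closure_of D \<subseteq> X closure_of (\<Union>d\<in>D. E d)" if "D \<subseteq> Y" for D
  proof (rule closure_of_minimal)
    show "D \<subseteq> X closure_of (\<Union>d\<in>D. E d)"
    proof
      fix d assume d: "d \<in> D"
      then have "d \<in> X closure_of (E d)"
        using E that by (meson subsetD)
      moreover have "X closure_of (E d) \<subseteq> X closure_of (\<Union>d\<in>D. E d)"
        using d by (intro closure_of_mono) auto
      ultimately show "d \<in> X closure_of (\<Union>d\<in>D. E d)"
        by (rule subsetD[rotated])
    qed
  qed auto
  have ES: "(\<Union>d\<in>D. E d) \<subseteq> S" if "D \<subseteq> Y" for D
  proof (rule UN_least)
    show "E d \<subseteq> S" if "d \<in> D" for d
      using E[OF subsetD[OF \<open>D \<subseteq> Y\<close> that]] by simp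
  qed
  have YM: "Y \<subseteq> X closure_of V - S"
    using VclV by (auto simp: Y_def)
  have MX: "X closure_of V - S \<subseteq> topspace X"
    using closure_of_subset_topspace[of X V] by auto
  obtain D where D: "countable D" "D \<subseteq> Y" "Y \<subseteq> X closure_of D"
  proof (rule separable_subset_of_trace_metabase[OF compact MX M YM, of "\<lambda>d. \<Union>c\<in>E d. B c"])
    show "countable (\<Union>c\<in>E d. B c)" if "d \<in> Y" for d
      using E[OF that] by (intro countable_UN countable_B) (auto dest: subsetD)
    fix D x z
    assume D: "countable D" "D \<subseteq> Y" and x: "x \<in> X closure_of D" "x \<notin> X closure_of V - S" and z: "z \<in> Y"
    have "X closure_of D \<subseteq> X closure_of V"
      using D(2) by (intro closure_of_mono) (auto simp: Y_def)
    then have "x \<in> S"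
      using x by auto
    moreover have "z \<notin> S"
      using z by (simp add: Y_def)
    ultimately have "x \<noteq> z"
      by auto
    have "x \<in> X closure_of (\<Union>d\<in>D. E d)"
      using clE[OF D(2)] x(1) by (rule subsetD)
    from avoiding_B[OF ES[OF D(2)] \<open>x \<in> S\<close> this \<open>x \<noteq> z\<close>]
    show "\<exists>W\<in>\<Union>d\<in>D. \<Union>c\<in>E d. B c. openin X W \<and> x \<in> W \<and> z \<notin> W"
      by simp
  qed auto
  have "V \<subseteq> X closure_of Y"
  proof
    fix v assume v: "v \<in> V"
    show "v \<in> X closure_of Y"
      unfolding in_closure_of
    proof (intro conjI allI impI)
      show "v \<in> topspace X"
        using v VX by (rule subsetD[rotated])
      fix U assume U: "v \<in> U \<and> openin X U"
      have "openin X (U \<inter> V)" "U \<inter> V \<noteq> {}"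
        using U V v by auto
      then obtain y where "y \<in> U \<inter> V - S" "\<exists>E. countable E \<and> E \<subseteq> S \<and> y \<in> X closure_of E"
        using countably_approachable_dense by meson
      then show "\<exists>y. y \<in> Y \<and> y \<in> U"
        by (auto simp: Y_def)
    qed
  qed
  also have "X closure_of Y \<subseteq> X closure_of D"
    using D(3) by (intro closure_of_minimal) auto
  also have "\<dots> \<subseteq> X closure_of (\<Union>d\<in>D. E d)"
    by (rule clE[OF D(2)])
  finally show thesis
    using that[of "\<Union>d\<in>D. E d"] D(1) E subsetD[OF D(2)] ES[OF D(2)] by auto
qed

text \<open>Let \<open>\<B>\<close> be a countable family that contains a base at the points of \<open>S\<close> in the closure of \<open>V\<close>. Every
  subset of \<open>V - S\<close> is separable, so a countable \<open>D\<close> can be closed off to be dense in \<open>V - S - \<Union>F\<close> for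
  every finite family \<open>F\<close> of sets that are in \<open>\<B>\<close> or are members of \<open>\<P>\<close> meeting \<open>D\<close>. These
  complements are the network at the points of the remainder: if a finite family from \<open>\<P> \<union> \<B>\<close> covers
  the part of \<open>D\<close> away from \<open>x\<close> but not \<open>x\<close>, its members that belong to \<open>\<B>\<close> or meet \<open>D\<close> do the same,
  and by the density of \<open>D\<close> the complement of their union stays close to \<open>x\<close>.\<close>

lemma open_set_countably_networked:
  assumes V: "openin X V" and M: "trace_metabase X (X closure_of V - S) \<P>"
  shows "countably_networked X V"
proof -
  define M where "M = X closure_of V - S"
  have M: "trace_metabase X M \<P>" and MX: "M \<subseteq> topspace X"
    using M closure_of_subset_topspace[of X V] by (auto simp: M_def)
  have VX: "V \<subseteq> topspace X"
    using V by (rule openin_subset)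
  have VclV: "V \<subseteq> X closure_of V"
    using VX by (rule closure_of_subset)
  have VM: "V - S \<subseteq> M"
    using VclV by (auto simp: M_def)
  obtain E where E: "countable E" "E \<subseteq> S" "V \<subseteq> X closure_of E"
    using countably_approachable_open_set[OF V assms(2)] by metis
  have clVE: "X closure_of V \<subseteq> X closure_of E"
    using E(3) by (intro closure_of_minimal) auto
  define \<B> where "\<B> = (\<Union>d\<in>E. B d)"
  have cB: "countable \<B>"
    unfolding \<B>_def using E(1) by (rule countable_UN) (use E(2) countable_B in auto)
  have avoid: "\<exists>W\<in>\<B>. openin X W \<and> x \<in> W \<and> z \<notin> W"
    if "x \<in> X closure_of V" "x \<in> S" "x \<noteq> z" for x z
    unfolding \<B>_def using that clVE by (intro avoiding_B E(2)) auto
  have sep: "\<exists>D. countable D \<and> D \<subseteq> A \<and> A \<subseteq> X closure_of D" if A: "A \<subseteq> V - S" for A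
  proof -
    have AM: "A \<subseteq> M"
      using A VM by (rule subset_trans)
    show ?thesis
    proof (rule separable_subset_of_trace_metabase[OF compact MX M AM, of "\<lambda>_. \<B>"])
      fix D x z assume D: "countable D" "D \<subseteq> A" "x \<in> X closure_of D" "x \<notin> M" "z \<in> A"
      have "X closure_of D \<subseteq> X closure_of V"
        using D(2) A by (intro closure_of_mono) auto
      then have x: "x \<in> X closure_of V"
        using D(3) by (rule subsetD)
      then have "x \<in> S"
        using D(4) by (simp add: M_def)
      moreover have "z \<notin> S"
        using D(5) A by auto
      ultimately have "x \<noteq> z"
        by auto
      then have "\<exists>W\<in>\<B>. openin X W \<and> x \<in> W \<and> z \<notin> W"
        using avoid x \<open>x \<in> S\<close> by simp
      moreover have "D \<noteq> {}"
        using D(3) by auto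
      ultimately show "\<exists>W\<in>\<Union>d\<in>D. \<B>. openin X W \<and> x \<in> W \<and> z \<notin> W"
        by simp
    qed (use cB in auto)
  qed
  have "\<forall>F. \<exists>D. countable D \<and> D \<subseteq> V - S - \<Union>F \<and> V - S - \<Union>F \<subseteq> X closure_of D"
    using sep by simp
  then obtain g where g: "\<And>F. countable (g F)" "\<And>F. g F \<subseteq> V - S - \<Union>F"
      "\<And>F. V - S - \<Union>F \<subseteq> X closure_of (g F)"
    by metis
  define R where "R d = {P \<in> \<P>. d \<in> P} \<union> \<B>" for d
  have cR: "countable (R d)" if "d \<in> V - S" for d
    using cB trace_metabaseD(1)[OF M subsetD[OF VM that]] by (simp add: R_def)
  have gV: "countable (g F) \<and> g F \<subseteq> V - S" for F
    using g(1,2)[of F] by auto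
  obtain D where D: "countable D" "D \<subseteq> V - S"
    and closed: "\<And>F. finite F \<Longrightarrow> F \<subseteq> (\<Union>d\<in>D. R d) \<Longrightarrow> g F \<subseteq> D"
    using countable_closing_off[of "V - S" R g, OF cR gV] by metis
  define \<F> where "\<F> = {F. finite F \<and> F \<subseteq> (\<Union>d\<in>D. R d)}"
  have "countable (\<Union>d\<in>D. R d)"
    using D(1) by (rule countable_UN) (use cR D(2) in auto)
  then have cF: "countable \<F>"
    unfolding \<F>_def by (rule countable_Collect_finite_subset)
  define \<N> where "\<N> = \<B> \<union> (\<lambda>F. V - S - \<Union>F) ` \<F>"
  have "\<exists>N\<in>\<N>. x \<in> N \<and> N \<subseteq> U" if x: "x \<in> V" and U: "openin X U" "x \<in> U" for x U
  proof (cases "x \<in> S")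
    case True
    have "x \<in> X closure_of E"
      using E(3) x by (rule subsetD)
    then have "\<exists>d\<in>E. \<exists>W\<in>B d. x \<in> W \<and> W \<subseteq> U"
      using base_B[OF E(2) True _ U] by simp
    then show ?thesis
      by (auto simp: \<N>_def \<B>_def)
  next
    case False
    then have xY: "x \<in> V - S"
      using x by simp
    \<comment> \<open>The family \<open>\<B>\<close> enters the closing-off through the points of \<open>D\<close>, so \<open>D\<close> must be nonempty.\<close>
    have "x \<in> X closure_of (g {})"
      using g(3)[of "{}"] xY by auto
    moreover have "g {} \<subseteq> D"
      by (rule closed) auto
    ultimately have "D \<noteq> {}"
      by auto
    obtain U' where U': "openin X U'" "x \<in> U'" "X closure_of U' \<subseteq> U"
      using regular_space_closure_nbhd[OF regular U] by metis
    define K where "K = X closure_of V - U'"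
    have K: "compactin X K"
      unfolding K_def using compact U'(1) by (intro closedin_compact_space closedin_diff) auto
    have "\<exists>W F. openin X W \<and> t \<in> W \<and> finite F \<and> F \<subseteq> \<P> \<union> \<B> \<and> W \<inter> M \<subseteq> \<Union>F \<and> x \<notin> \<Union>F"
      if t: "t \<in> K" for t
    proof -
      have "t \<noteq> x" and tV: "t \<in> X closure_of V"
        using t U'(2) by (auto simp: K_def)
      show ?thesis
      proof (cases "t \<in> S")
        case True
        then obtain W where "W \<in> \<B>" "openin X W" "t \<in> W" "x \<notin> W"
          using avoid[OF tV _ \<open>t \<noteq> x\<close>] by auto
        then show ?thesis
          by (intro exI[of _ W] exI[of _ "{W}"]) auto
      next
        case False
        then have "t \<in> M"
          using tV by (simp add: M_def)
        from trace_metabaseD(2)[OF M this subsetD[OF VM xY] \<open>t \<noteq> x\<close>]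
        obtain W F where "openin X W" "t \<in> W" "finite F" "F \<subseteq> \<P>" "W \<inter> M \<subseteq> \<Union>F" "x \<notin> \<Union>F"
          by (elim exE conjE)
        then show ?thesis
          by (intro exI[of _ W] exI[of _ F]) auto
      qed
    qed
    then have "\<exists>F. finite F \<and> F \<subseteq> \<P> \<union> \<B> \<and> K \<inter> M \<subseteq> \<Union>F \<and> x \<notin> \<Union>F"
      by (rule compactin_finite_cover_avoiding[OF K])
    then obtain F where F: "finite F" "F \<subseteq> \<P> \<union> \<B>" "K \<inter> M \<subseteq> \<Union>F" "x \<notin> \<Union>F"
      by (elim exE conjE)
    define F' where "F' = {P \<in> F. P \<in> \<B> \<or> P \<inter> D \<noteq> {}}"
    have "F' \<subseteq> (\<Union>d\<in>D. R d)"
    proof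
      fix P assume P: "P \<in> F'"
      show "P \<in> (\<Union>d\<in>D. R d)"
      proof (cases "P \<in> \<B>")
        case True
        then show ?thesis
          using \<open>D \<noteq> {}\<close> by (auto simp: R_def)
      next
        case False
        then have "P \<in> \<P>" "P \<inter> D \<noteq> {}"
          using P F(2) by (auto simp: F'_def)
        then show ?thesis
          by (auto simp: R_def)
      qed
    qed
    moreover have "finite F'"
      using F(1) by (simp add: F'_def)
    ultimately have F'\<F>: "F' \<in> \<F>" and gF': "g F' \<subseteq> D"
      using closed[of F'] by (auto simp: \<F>_def)
    have "V - S - \<Union>F' \<subseteq> U"
    proof
      fix t assume t: "t \<in> V - S - \<Union>F'"
      show "t \<in> U"
      proof (rule ccontr)
        assume "t \<notin> U"
        have "t \<in> topspace X"
          using t VX by auto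
        moreover have "t \<notin> X closure_of U'"
          using \<open>t \<notin> U\<close> U'(3) by (meson subsetD)
        ultimately have "t \<in> topspace X - X closure_of U'"
          by simp
        moreover have "openin X (topspace X - X closure_of U')"
          by (simp add: openin_diff)
        moreover have "t \<in> X closure_of (g F')"
          using g(3)[of F'] t by (rule subsetD)
        ultimately obtain d where d: "d \<in> g F'" "d \<in> topspace X - X closure_of U'"
          unfolding in_closure_of by meson
        have "d \<in> V - S - \<Union>F'"
          using g(2)[of F'] d(1) by (rule subsetD)
        moreover have "d \<notin> U'"
          using d(2) closure_of_subset[OF openin_subset[OF U'(1)]] by (meson DiffD2 subsetD)
        ultimately have "d \<in> K \<inter> M"
          using VM VclV by (auto simp: K_def)
        then obtain P where P: "P \<in> F" "d \<in> P"
          using F(3) by (meson UnionE subsetD)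
        have "d \<in> D"
          using gF' d(1) by (rule subsetD)
        then have "P \<in> F'"
          using P by (auto simp: F'_def)
        then show False
          using P(2) \<open>d \<in> V - S - \<Union>F'\<close> by auto
      qed
    qed
    moreover have "x \<in> V - S - \<Union>F'"
      using xY F(4) by (auto simp: F'_def)
    ultimately show ?thesis
      using F'\<F> by (auto simp: \<N>_def)
  qed
  moreover have "countable \<N>"
    using cB cF by (simp add: \<N>_def)
  ultimately show ?thesis
    unfolding countably_networked_def by (intro exI[of _ \<N>]) simp
qed

text \<open>The points without a countably networked neighbourhood form a compact subset \<open>L\<close> of \<open>S\<close>. Such a set
  is separable and so has a countable outer base, by the sets attached to a dense sequence.
  Therefore the complement of \<open>L\<close> is a countable union of compact sets, each of which is covered by
  finitely many countably networked open sets.\<close>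

lemma countably_networked_if_remainder_locally:
  assumes loc: "\<And>y. y \<in> topspace X - S \<Longrightarrow> \<exists>V. openin X V \<and> y \<in> V \<and> countably_networked X V"
  shows "countably_networked X (topspace X)"
proof -
  define Z where "Z = \<Union>{V. openin X V \<and> countably_networked X V}"
  define L where "L = topspace X - Z"
  have opZ: "openin X Z"
    by (auto simp: Z_def)
  then have clL: "closedin X L"
    by (simp add: L_def closedin_diff)
  have LS: "L \<subseteq> S"
    using loc by (force simp: L_def Z_def)
  have L: "compactin X L"
    using compact clL by (rule closedin_compact_space)
  have "X closure_of D \<subseteq> S" if "countable D" "D \<subseteq> L" for D
    using closure_of_minimal[OF that(2) clL] LS by (rule subset_trans)
  from separable_if_closed_in_S[OF LS this]
  obtain D where D: "countable D" "D \<subseteq> L" "L \<subseteq> X closure_of D"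
    by metis
  have DS: "D \<subseteq> S"
    using D(2) LS by (rule subset_trans)
  define \<B> where "\<B> = (\<Union>d\<in>D. B d)"
  have cB: "countable \<B>"
    unfolding \<B>_def using D(1) by (rule countable_UN) (use DS countable_B in auto)
  have opB: "openin X W" if "W \<in> \<B>" for W
    using that DS open_B by (auto simp: \<B>_def)
  have netL: "countably_networked X L"
    unfolding countably_networked_def
  proof (intro exI[of _ \<B>] conjI cB ballI allI impI)
    fix x U assume x: "x \<in> L" and U: "openin X U \<and> x \<in> U"
    have "\<exists>d\<in>D. \<exists>W\<in>B d. x \<in> W \<and> W \<subseteq> U"
      using base_B[OF DS subsetD[OF LS x] subsetD[OF D(3) x]] U by simp
    then show "\<exists>N\<in>\<B>. x \<in> N \<and> N \<subseteq> U"
      by (auto simp: \<B>_def)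
  qed
  define \<F> where "\<F> = {F. finite F \<and> F \<subseteq> \<B>}"
  have cF: "countable \<F>"
    unfolding \<F>_def using cB by (rule countable_Collect_finite_subset)
  define \<G> where "\<G> = {F \<in> \<F>. L \<subseteq> \<Union>F}"
  have netF: "countably_networked X (topspace X - \<Union>F)" if F: "F \<in> \<G>" for F
  proof -
    have "openin X (\<Union>F)"
      using F opB by (auto simp: \<G>_def \<F>_def)
    then have "compactin X (topspace X - \<Union>F)"
      using compact by (intro closedin_compact_space closedin_diff) auto
    moreover have "topspace X - \<Union>F \<subseteq> Z"
      using F by (auto simp: \<G>_def L_def)
    ultimately have "\<exists>\<V>. finite \<V> \<and> \<V> \<subseteq> {V. openin X V \<and> countably_networked X V} \<and> topspace X - \<Union>F \<subseteq> \<Union>\<V>"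
      unfolding Z_def compactin_def by simp
    then obtain \<V> where \<V>: "finite \<V>" "\<V> \<subseteq> {V. openin X V \<and> countably_networked X V}" "topspace X - \<Union>F \<subseteq> \<Union>\<V>"
      by (elim exE conjE)
    have "countably_networked X (\<Union>V\<in>\<V>. V)"
      using \<V>(2) by (intro countably_networked_UN countable_finite \<V>(1)) auto
    then show ?thesis
      using \<V>(3) by (auto intro: countably_networked_subset)
  qed
  have cover: "topspace X \<subseteq> L \<union> (\<Union>F\<in>\<G>. topspace X - \<Union>F)"
  proof
    fix z assume z: "z \<in> topspace X"
    show "z \<in> L \<union> (\<Union>F\<in>\<G>. topspace X - \<Union>F)"
    proof (cases "z \<in> L")
      case False
      have "\<exists>W F. openin X W \<and> x \<in> W \<and> finite F \<and> F \<subseteq> \<B> \<and> W \<inter> topspace X \<subseteq> \<Union>F \<and> z \<notin> \<Union>F"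
        if x: "x \<in> L" for x
      proof -
        have "x \<noteq> z"
          using x False by auto
        from avoiding_B[OF DS subsetD[OF LS x] subsetD[OF D(3) x] this]
        obtain W where "W \<in> \<B>" "openin X W" "x \<in> W" "z \<notin> W"
          unfolding \<B>_def by (elim bexE conjE)
        then show ?thesis
          by (intro exI[of _ W] exI[of _ "{W}"]) auto
      qed
      then have "\<exists>F. finite F \<and> F \<subseteq> \<B> \<and> L \<inter> topspace X \<subseteq> \<Union>F \<and> z \<notin> \<Union>F"
        by (rule compactin_finite_cover_avoiding[OF L])
      then obtain F where F: "finite F" "F \<subseteq> \<B>" "L \<inter> topspace X \<subseteq> \<Union>F" "z \<notin> \<Union>F"
        by (elim exE conjE)
      then have "F \<in> \<G>"
        using closedin_subset[OF clL] by (auto simp: \<G>_def \<F>_def)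
      then show ?thesis
        using z F(4) by auto
    qed simp
  qed
  have "countable \<G>"
    using cF by (simp add: \<G>_def)
  then have "countably_networked X (L \<union> (\<Union>F\<in>\<G>. topspace X - \<Union>F))"
    using netL netF by (intro countably_networked_Un countably_networked_UN)
  then show ?thesis
    using cover by (rule countably_networked_subset)
qed

end

section \<open>Remainders of rectifiable suborderable spaces\<close>

lemma locally_compact_if_homogeneous:
  assumes hom: "\<And>x y. x \<in> topspace T \<Longrightarrow> y \<in> topspace T \<Longrightarrow> \<exists>h. homeomorphic_map T T h \<and> h x = y"
    and K: "compactin T K" "openin T U" "x \<in> U" "U \<subseteq> K"
  shows "locally_compact_space T"
  unfolding locally_compact_space_def
proof (intro ballI)
  fix y assume y: "y \<in> topspace T"
  have "x \<in> topspace T"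
    using openin_subset[OF K(2)] K(3) by (rule subsetD)
  from hom[OF this y] obtain h where h: "homeomorphic_map T T h" "h x = y"
    by (elim exE conjE)
  have "openin T (h ` U)"
    using homeomorphic_imp_open_map[OF h(1)] K(2) by (simp add: open_map_def)
  moreover have "compactin T (h ` K)"
    using image_compactin[OF K(1) homeomorphic_imp_continuous_map[OF h(1)]] .
  moreover have "y \<in> h ` U" "h ` U \<subseteq> h ` K"
    using h(2) K(3,4) by auto
  ultimately show "\<exists>U K. openin T U \<and> compactin T K \<and> y \<in> U \<and> U \<subseteq> K"
    by (intro exI[of _ "h ` U"] exI[of _ "h ` K"]) simp
qed

text \<open>A nonempty open subset of \<open>X\<close> inside \<open>S\<close> would make \<open>S\<close> locally compact at its points, and by
  homogeneity \<open>S\<close> would be locally compact everywhere.\<close>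

lemma dense_codense_if_homogeneous:
  assumes X: "compact_space X" "Hausdorff_space X" "S \<subseteq> topspace X" "X closure_of S = topspace X"
    and hom: "\<And>x y. x \<in> S \<Longrightarrow> y \<in> S \<Longrightarrow> \<exists>h. homeomorphic_map (subtopology X S) (subtopology X S) h \<and> h x = y"
    and nlc: "\<not> locally_compact_space (subtopology X S)"
  shows "dense_codense X S"
proof
  show "X closure_of (topspace X - S) = topspace X"
  proof (rule ccontr)
    assume "X closure_of (topspace X - S) \<noteq> topspace X"
    then obtain x where x: "x \<in> topspace X" "x \<notin> X closure_of (topspace X - S)"
      using closure_of_subset_topspace[of X "topspace X - S"] by blast
    define V where "V = topspace X - X closure_of (topspace X - S)"
    have V: "openin X V" "x \<in> V"
      using x by (auto simp: V_def openin_diff)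
    have "topspace X - S \<subseteq> X closure_of (topspace X - S)"
      by (intro closure_of_subset) auto
    then have VS: "V \<subseteq> S"
      by (auto simp: V_def)
    obtain U where U: "openin X U" "x \<in> U" "X closure_of U \<subseteq> V"
      using regular_space_closure_nbhd[OF compact_Hausdorff_imp_regular_space V] X(1,2) by metis
    have "U \<subseteq> X closure_of U"
      using openin_subset[OF U(1)] by (rule closure_of_subset)
    have TS: "topspace (subtopology X S) = S"
      using X(3) by auto
    have "compactin X (X closure_of U)"
      using X(1) by (simp add: closedin_compact_space)
    then have "compactin (subtopology X S) (X closure_of U)"
      using U(3) VS by (simp add: compactin_subtopology)
    moreover have "openin (subtopology X S) U"
      unfolding openin_subtopology using U VS \<open>U \<subseteq> X closure_of U\<close> by (intro exI[of _ U]) auto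
    ultimately have "locally_compact_space (subtopology X S)"
      using locally_compact_if_homogeneous[of "subtopology X S" "X closure_of U" U x] hom TS U(2)
        \<open>U \<subseteq> X closure_of U\<close> by simp
    then show False
      using nlc by simp
  qed
qed (use X in auto)

text \<open>The sets given by \<open>base_from_dense_subset\<close> are open in \<open>S\<close> only. Each \<open>A\<close> among them is replaced by
  its largest open extension to \<open>X\<close>, which by density stays inside the closure of \<open>A\<close>; regularity
  of \<open>X\<close> then gives a base in \<open>X\<close>.\<close>

lemma (in dense_codense) closure_based_if_first_countable_rectification:
  assumes "rectification (subtopology X S) e p q"
    and U: "\<And>n. openin (subtopology X S) (U n)" "\<And>n. e \<in> U n"
    and base: "\<And>V. openin (subtopology X S) V \<Longrightarrow> e \<in> V \<Longrightarrow> \<exists>n::nat. U n \<subseteq> V"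
  shows "\<exists>B. closure_based X S B"
proof -
  interpret rectification "subtopology X S" e p q
    by fact
  have TS: "topspace (subtopology X S) = S"
    using S_sub by auto
  define Q where "Q d n = {y \<in> S. p d y \<in> U n}" for d n
  define ext where "ext A = topspace X - X closure_of (S - A)" for A
  have opext: "openin X (ext A)" for A
    by (simp add: ext_def openin_diff)
  have opQ: "openin (subtopology X S) (Q d n)" if "d \<in> S" for d n
    using openin_p_preimage[OF _ U(1), of d n] that unfolding TS Q_def by simp
  have in_ext: "x \<in> ext A" if A: "openin (subtopology X S) A" "x \<in> A" for A x
  proof -
    obtain O' where O: "openin X O'" "A = O' \<inter> S"
      using A(1) unfolding openin_subtopology by (elim exE conjE)
    have "x \<notin> X closure_of (S - A)"
      using A(2) O unfolding in_closure_of by blast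
    then show ?thesis
      using A(2) O S_sub by (auto simp: ext_def)
  qed
  have ext_sub: "ext A \<subseteq> X closure_of A" for A
  proof -
    have "A \<inter> S \<union> (S - A) = S"
      by auto
    then have "topspace X = X closure_of (A \<inter> S) \<union> X closure_of (S - A)"
      using dense closure_of_Un[of X "A \<inter> S" "S - A"] by simp
    then have "ext A \<subseteq> X closure_of (A \<inter> S)"
      by (auto simp: ext_def)
    also have "\<dots> \<subseteq> X closure_of A"
      by (intro closure_of_mono) auto
    finally show ?thesis .
  qed
  have "closure_based X S (\<lambda>d. range (\<lambda>n. ext (Q d n)))"
  proof unfold_locales
    fix D x V
    assume D: "D \<subseteq> S" and x: "x \<in> S" "x \<in> X closure_of D" and V: "openin X V" "x \<in> V"
    obtain V' where V': "openin X V'" "x \<in> V'" "X closure_of V' \<subseteq> V"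
      using regular_space_closure_nbhd[OF regular V] by metis
    have "x \<in> subtopology X S closure_of D"
      using D x by (simp add: closure_of_subtopology Int_absorb1)
    moreover have "openin (subtopology X S) (S \<inter> V')" "x \<in> S \<inter> V'"
      using V' x(1) by (auto simp: openin_subtopology_Int2)
    ultimately have "\<exists>d\<in>D. \<exists>n. p d x \<in> U n \<and> {y \<in> topspace (subtopology X S). p d y \<in> U n} \<subseteq> S \<inter> V'"
      by (intro base_from_dense_subset base U)
    then obtain d n where d: "d \<in> D" "p d x \<in> U n" "{y \<in> S. p d y \<in> U n} \<subseteq> S \<inter> V'"
      unfolding TS by (elim bexE exE conjE)
    then have "x \<in> Q d n" "Q d n \<subseteq> V'"
      using x(1) by (auto simp: Q_def)
    have "x \<in> ext (Q d n)"
      using in_ext[OF opQ \<open>x \<in> Q d n\<close>] d(1) D by auto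
    moreover have "ext (Q d n) \<subseteq> V"
      using ext_sub[of "Q d n"] closure_of_mono[OF \<open>Q d n \<subseteq> V'\<close>, of X] V'(3) by (meson subset_trans)
    ultimately show "\<exists>d\<in>D. \<exists>W\<in>range (\<lambda>n. ext (Q d n)). x \<in> W \<and> W \<subseteq> V"
      using d(1) by (intro bexI[of _ d] bexI[of _ "ext (Q d n)"]) auto
  qed (auto simp: opext)
  then show ?thesis
    by (rule exI[of "closure_based X S"])
qed

lemma compactification_countably_networked:
  assumes X: "compact_space X" "Hausdorff_space X" "S \<subseteq> topspace X" "X closure_of S = topspace X"
    and nlc: "\<not> locally_compact_space (subtopology X S)"
    and GO: "GO_space TYPE('l::linorder_topology) (subtopology X S)"
    and rect: "rectifiable_space (subtopology X S)"
    and loc: "has_locally has_point_countable_p_metabase (subtopology X (topspace X - S))"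
  shows "countably_networked X (topspace X)"
proof -
  have TS: "topspace (subtopology X S) = S"
    using X(3) by auto
  obtain e p q where R: "rectification (subtopology X S) e p q"
    using rectifiable_imp_rectification[OF rect] by metis
  then interpret rectification "subtopology X S" e p q .
  have "\<exists>h. homeomorphic_map (subtopology X S) (subtopology X S) h \<and> h x = y" if "x \<in> S" "y \<in> S" for x y
    using homogeneous[of x y] that unfolding TS by metis
  then interpret dense_codense X S
    using dense_codense_if_homogeneous[OF X _ nlc] by simp
  have Vex: "\<exists>V \<P>. openin X V \<and> y \<in> V \<and> trace_metabase X (X closure_of V - S) \<P>" if y: "y \<in> topspace X - S" for y
  proof -
    obtain V \<P> where V: "openin X V" "y \<in> V" "trace_metabase X (X closure_of V \<inter> (topspace X - S)) \<P>"
      using local_trace_metabase[OF regular Diff_subset loc y] by metis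
    moreover have "X closure_of V \<inter> (topspace X - S) = X closure_of V - S"
      using closure_of_subset_topspace[of X V] by auto
    ultimately show ?thesis
      by auto
  qed
  from GO unit_in show ?thesis
  proof (cases rule: GO_space_point_dichotomy)
    case (countable_base U)
    then obtain B where "closure_based X S B"
      using closure_based_if_first_countable_rectification[OF R] by metis
    then interpret closure_based X S B .
    show ?thesis
      using Vex open_set_countably_networked by (intro countably_networked_if_remainder_locally) metis
  next
    case open_core
    have P: "\<exists>V. openin (subtopology X S) V \<and> x \<in> V \<and> (\<forall>n. V \<subseteq> W n)"
      if "x \<in> S" "\<And>n::nat. openin (subtopology X S) (W n) \<and> x \<in> W n" for x W
      by (rule P_space_if_countable_open_core[OF open_core]) (use that TS in \<open>simp_all del: topspace_subtopology\<close>)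
    have "topspace X - S \<noteq> {}"
    proof
      assume empty: "topspace X - S = {}"
      have "X closure_of {} = topspace X"
        using codense unfolding empty .
      then show False
        using unit_in TS S_sub by auto
    qed
    then obtain y where "y \<in> topspace X - S"
      by blast
    then obtain V \<P> where "openin X V" "y \<in> V" "trace_metabase X (X closure_of V - S) \<P>"
      using Vex by metis
    then show ?thesis
      using not_P_space_if_local_trace_metabase[OF countable_closure_avoids_P_space[OF P]] by blast
  qed
qed

theorem theorem4p20:
  fixes G :: "'a topology" and bG :: "'b topology" and i :: "'a \<Rightarrow> 'b"
  assumes "Tychonoff_space G"
    and "\<not> locally_compact_space G"
    and "GO_space TYPE('l::linorder_topology) G"
    and "rectifiable_space G"
    and "Hausdorff_compactification G bG i"
    and "has_locally has_point_countable_p_metabase (remainder G bG i)"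
  shows "separable_space G \<and> metrizable_space G \<and> separable_space bG \<and> metrizable_space bG"
proof -
  define S where "S = i ` topspace G"
  have bG: "compact_space bG" "Hausdorff_space bG" "bG closure_of S = topspace bG"
    and emb: "embedding_map G bG i"
    using assms(5) by (auto simp: Hausdorff_compactification_def S_def)
  have S: "S \<subseteq> topspace bG"
    using embedding_map_in_subtopology[of G bG "topspace bG" i] emb by (auto simp: S_def)
  have hom: "G homeomorphic_space subtopology bG S"
    using embedding_map_imp_homeomorphic_space[OF emb] by (simp add: S_def)
  have net: "countably_networked bG (topspace bG)"
  proof (rule compactification_countably_networked[OF bG(1,2) S bG(3)])
    show "\<not> locally_compact_space (subtopology bG S)"
      using assms(2) homeomorphic_locally_compact_space[OF hom] by simp
    show "rectifiable_space (subtopology bG S)"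
      using homeomorphic_rectifiable_space[OF hom assms(4)] .
    obtain L :: "'l set" where "G homeomorphic_space top_of_set L"
      using assms(3) unfolding GO_space_def by blast
    then have "subtopology bG S homeomorphic_space top_of_set L"
      using hom homeomorphic_space_sym homeomorphic_space_trans by metis
    then show "GO_space TYPE('l) (subtopology bG S)"
      unfolding GO_space_def ..
    show "has_locally has_point_countable_p_metabase (subtopology bG (topspace bG - S))"
      using assms(6) by (simp add: remainder_def S_def)
  qed
  have m: "metrizable_space bG"
    using compact_Hausdorff_countably_networked_imp_metrizable[OF bG(1,2) net] .
  have "separable_space (subtopology bG (topspace bG))" "separable_space (subtopology bG S)"
    using countably_networked_imp_separable[OF net order_refl]
      countably_networked_imp_separable[OF countably_networked_subset[OF net S] S] by auto
  then show ?thesis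
    using m metrizable_space_subtopology[OF m, of S] homeomorphic_separable_space[OF hom]
      homeomorphic_metrizable_space[OF hom] by simp
qed

end
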